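(* For $n\ge 3$, there is a short exact sequence $$1\to T_n'/T_n''\to T_n/T_n''\to (\mathbb{Z}/2\mathbb{Z})^{n-1}\to 1$$ such that $T_n/T_n''$ is a crystallographic group of dimension $2n-5$. Furthermore, $T_n/T_n''$ is not a Bieberbach group and admits only $2$-torsion (that is, every non-trivial element of finite order in $T_n/T_n''$ has order $2$).
   Context: The twin group is $T_n=\langle s_1,\dots,s_{n-1}\mid s_k^2=1 \text{ for all } k,\ s_is_j=s_js_i \text{ for } |i-j|\ge 2\rangle$. For a group $G$, $G'$ is its commutator subgroup and $G''=(G')'$. The group $(\mathbb{Z}/2\mathbb{Z})^{n-1}$ is the abelianisation of $T_n$ and the sequence is induced by the abelianisation map. A crystallographic group of dimension $d$ is a group isomorphic to a discrete uniform (i.e. cocompact) subgroup of $\mathbb{R}^d\rtimes \mathrm{O}(d,\mathbb{R})$. A Bieberbach group is a torsion free crystallographic group. *)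

theory Defs
  imports
    "HOL-Analysis.Product_Topology"
    "HOL-Algebra.Generated_Groups"
    "HOL-Algebra.Multiplicative_Group"
    "HOL-Algebra.Product_Groups"
    "Jordan_Normal_Form.Matrix"
begin

subsection \<open>Groups given by generators and relations\<close>

text \<open>The letter \<open>(x, True)\<close> stands for the generator \<open>x\<close>, the letter \<open>(x, False)\<close> for its
  formal inverse. A pair \<open>(u, v)\<close> in the set \<open>R\<close> of relations, whose members are meant to be
  words over \<open>S\<close>, stands for the relation \<open>u = v\<close>.\<close>

type_synonym 'a group_word = "('a \<times> bool) list"

inductive_set pres_cong ::
    "'a set \<Rightarrow> ('a group_word \<times> 'a group_word) set \<Rightarrow> ('a group_word \<times> 'a group_word) set"
  for S :: "'a set" and R :: "('a group_word \<times> 'a group_word) set"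
where
  relation: "(u, v) \<in> R \<Longrightarrow> (u, v) \<in> pres_cong S R"
| cancel: "x \<in> S \<Longrightarrow> ([(x, b), (x, \<not> b)], []) \<in> pres_cong S R"
| refl: "u \<in> lists (S \<times> UNIV) \<Longrightarrow> (u, u) \<in> pres_cong S R"
| sym: "(u, v) \<in> pres_cong S R \<Longrightarrow> (v, u) \<in> pres_cong S R"
| trans: "(u, v) \<in> pres_cong S R \<Longrightarrow> (v, w) \<in> pres_cong S R \<Longrightarrow> (u, w) \<in> pres_cong S R"
| append: "(u, u') \<in> pres_cong S R \<Longrightarrow> (v, v') \<in> pres_cong S R \<Longrightarrow>
    (u @ v, u' @ v') \<in> pres_cong S R"

definition presented_group ::
    "'a set \<Rightarrow> ('a group_word \<times> 'a group_word) set \<Rightarrow> 'a group_word set monoid" where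
  "presented_group S R =
    \<lparr>carrier = lists (S \<times> UNIV) // pres_cong S R,
     monoid.mult = (\<lambda>A B. \<Union>a\<in>A. \<Union>b\<in>B. pres_cong S R `` {a @ b}),
     one = pres_cong S R `` {[]}\<rparr>"

subsection \<open>Twin groups\<close>

definition twin_relations :: "nat \<Rightarrow> (nat group_word \<times> nat group_word) set" where
  "twin_relations n =
    {([(k, True), (k, True)], []) | k. k \<in> {1..<n}} \<union>
    {([(i, True), (j, True)], [(j, True), (i, True)]) | i j.
       i \<in> {1..<n} \<and> j \<in> {1..<n} \<and> \<bar>int i - int j\<bar> \<ge> 2}"

definition twin_group :: "nat \<Rightarrow> nat group_word set monoid" where
  "twin_group n = presented_group {1..<n} (twin_relations n)"

definition twin_gen :: "nat \<Rightarrow> nat \<Rightarrow> nat group_word set" where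
  "twin_gen n k = pres_cong {1..<n} (twin_relations n) `` {[(k, True)]}"

definition commutator_subgroup :: "('a, 'b) monoid_scheme \<Rightarrow> 'a set" where
  "commutator_subgroup G = derived G (carrier G)"

definition second_commutator_subgroup :: "('a, 'b) monoid_scheme \<Rightarrow> 'a set" where
  "second_commutator_subgroup G = derived G (commutator_subgroup G)"

definition Z2_power :: "nat \<Rightarrow> (nat \<Rightarrow> int) monoid" where
  "Z2_power m = product_group {1..m} (\<lambda>_. integer_mod_group 2)"

text \<open>The library's \<open>short_exact_sequence\<close> forces all groups to have elements of the same type.\<close>

definition short_exact ::
    "('a, 'r) monoid_scheme \<Rightarrow> ('b, 's) monoid_scheme \<Rightarrow> ('c, 't) monoid_scheme \<Rightarrow>
     ('a \<Rightarrow> 'b) \<Rightarrow> ('b \<Rightarrow> 'c) \<Rightarrow> bool" where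
  "short_exact A B C f g \<longleftrightarrow>
    group A \<and> group B \<and> group C \<and>
    f \<in> mon A B \<and> g \<in> epi B C \<and> f ` carrier A = kernel B C g"

subsection \<open>Crystallographic groups\<close>

text \<open>The pair \<open>(v, A)\<close> is the isometry \<open>x \<mapsto> A x + v\<close>.\<close>

definition euclidean_isometry_group :: "nat \<Rightarrow> (real vec \<times> real mat) monoid" where
  "euclidean_isometry_group d =
    \<lparr>carrier = carrier_vec d \<times> {A \<in> carrier_mat d d. transpose_mat A * A = 1\<^sub>m d},
     monoid.mult = (\<lambda>(v, A) (w, B). (v + A *\<^sub>v w, A * B)),
     one = (0\<^sub>v d, 1\<^sub>m d)\<rparr>"

text \<open>The usual topology, as a subspace of the Euclidean space of all entries.\<close>

definition euclidean_isometry_topology :: "nat \<Rightarrow> (real vec \<times> real mat) topology" where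
  "euclidean_isometry_topology d =
    pullback_topology (carrier (euclidean_isometry_group d))
      (\<lambda>(v, A). (\<lambda>i\<in>{..<d}. v $ i, \<lambda>p\<in>{..<d} \<times> {..<d}. A $$ p))
      (prod_topology (product_topology (\<lambda>_. euclideanreal) {..<d})
                     (product_topology (\<lambda>_. euclideanreal) ({..<d} \<times> {..<d})))"

definition discrete_subgroup :: "nat \<Rightarrow> (real vec \<times> real mat) set \<Rightarrow> bool" where
  "discrete_subgroup d H \<longleftrightarrow>
    subgroup H (euclidean_isometry_group d) \<and>
    subtopology (euclidean_isometry_topology d) H = discrete_topology H"

text \<open>The topology \<open>Q\<close> below is uniquely determined: it is the quotient topology on the set of
  cosets of \<open>H\<close>.\<close>

definition uniform_subgroup :: "nat \<Rightarrow> (real vec \<times> real mat) set \<Rightarrow> bool" where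
  "uniform_subgroup d H \<longleftrightarrow>
    subgroup H (euclidean_isometry_group d) \<and>
    (\<exists>Q. quotient_map (euclidean_isometry_topology d) Q
            (\<lambda>g. H #>\<^bsub>euclidean_isometry_group d\<^esub> g) \<and>
         compact_space Q)"

definition crystallographic_group :: "nat \<Rightarrow> ('a, 'b) monoid_scheme \<Rightarrow> bool" where
  "crystallographic_group d G \<longleftrightarrow> group G \<and>
    (\<exists>H. discrete_subgroup d H \<and> uniform_subgroup d H \<and>
         G \<cong> (euclidean_isometry_group d)\<lparr>carrier := H\<rparr>)"

text \<open>The library's \<open>ord\<close> is 0 for elements of infinite order.\<close>

definition torsion_free_group :: "('a, 'b) monoid_scheme \<Rightarrow> bool" where
  "torsion_free_group G \<longleftrightarrow> group G \<and>
    (\<forall>x\<in>carrier G. x \<noteq> \<one>\<^bsub>G\<^esub> \<longrightarrow> group.ord G x = 0)"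

definition bieberbach_group :: "('a, 'b) monoid_scheme \<Rightarrow> bool" where
  "bieberbach_group G \<longleftrightarrow> torsion_free_group G \<and> (\<exists>d. crystallographic_group d G)"

end

theory Submission
  imports Defs "HOL-Analysis.Abstract_Limits" "Jordan_Normal_Form.Determinant"
begin

text \<open>
  Let \<open>T\<close> be the twin group with generators \<open>s\<^sub>1, \<dots>, s\<^sub>n\<^sub>-\<^sub>1\<close>. The theorem is proved by exhibiting \<open>2n - 5\<close>
  actions of \<open>T\<close> on the integers by translations and reflections and showing that together they have
  kernel exactly \<open>T''\<close>. There is one action for each pair \<open>{i, i + 1}\<close> of indices, in which \<open>s\<^sub>i\<close> acts as
  \<open>x \<mapsto> - x\<close> and \<open>s\<^sub>i\<^sub>+\<^sub>1\<close> as \<open>x \<mapsto> 1 - x\<close>, and one for each triple \<open>{i, i + 1, i + 2}\<close>, in which the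
  commuting generators \<open>s\<^sub>i\<close> and \<open>s\<^sub>i\<^sub>+\<^sub>2\<close> both act as \<open>x \<mapsto> - x\<close> and \<open>s\<^sub>i\<^sub>+\<^sub>1\<close> as \<open>x \<mapsto> 1 - x\<close>; the
  other generators act trivially. These \<open>(n - 2) + (n - 3)\<close> sets are the nonempty index sets on which
  the commutation graph of the generators is disconnected, which is why they account for the whole first
  homology of \<open>T'\<close>.

  An element of \<open>T'\<close> acts by translations, so \<open>T''\<close> acts trivially. For the converse, an element of the
  common kernel first lies in \<open>T'\<close>, since the parities of its translation parts and its signs recover
  the exponents of the generators modulo 2 (\<open>coord_kernel_derived\<close>). The quotient \<open>T' / T''\<close> is an
  abelian group on which \<open>T\<close> acts by conjugation through the abelianisation. It is generated by the
  \<open>n - 2\<close> commutators \<open>c\<^sub>i = [s\<^sub>i, s\<^sub>i\<^sub>+\<^sub>1]\<close> and the \<open>n - 3\<close> elements \<open>e\<^sub>i = (1 - s\<^sub>i\<^sub>+\<^sub>2) c\<^sub>i\<close>, because the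
  subgroup that they generate is stable under conjugation (\<open>D_eq_generate_basis\<close>). The point is the
  relation \<open>(1 - s\<^sub>i\<^sub>+\<^sub>2) c\<^sub>i = (s\<^sub>i - 1) c\<^sub>i\<^sub>+\<^sub>1\<close> (\<open>twisted_comm_eq\<close>), obtained from the two expansions of
  the commutator of \<open>s\<^sub>i s\<^sub>i\<^sub>+\<^sub>2\<close> with \<open>s\<^sub>i\<^sub>+\<^sub>1\<close>: it makes each \<open>e\<^sub>i\<close> an eigenvector of all generators. The
  translations by which these \<open>2n - 5\<close> elements act form a nonsingular triangular matrix, so the
  actions are faithful on \<open>T' / T''\<close> and the translations in the image contain all multiples of 4.

  The product of the actions embeds \<open>T / T''\<close> into the isometries of Euclidean space of dimension
  \<open>2n - 5\<close>. The image has integral entries, hence is discrete, and it contains a full lattice of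
  translations, hence is uniform. Torsion is read off in the coordinates: a translation of finite order
  is trivial and a reflection is an involution. The class of \<open>s\<^sub>1\<close> is such a torsion element.
\<close>

section \<open>Groups given by generators and relations\<close>

definition formal_inverse :: "'a group_word \<Rightarrow> 'a group_word" where
  "formal_inverse w = map (\<lambda>(x, b). (x, \<not> b)) (rev w)"

definition eval_word :: "('b, 'c) monoid_scheme \<Rightarrow> ('a \<Rightarrow> 'b) \<Rightarrow> 'a group_word \<Rightarrow> 'b" where
  "eval_word K f w =
     foldr (\<lambda>(x, b) y. (if b then f x else inv\<^bsub>K\<^esub> f x) \<otimes>\<^bsub>K\<^esub> y) w \<one>\<^bsub>K\<^esub>"

lemma eval_word_Nil [simp]: "eval_word K f [] = \<one>\<^bsub>K\<^esub>"
  by (simp add: eval_word_def)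

lemma eval_word_Cons [simp]:
  "eval_word K f ((x, b) # w) = (if b then f x else inv\<^bsub>K\<^esub> f x) \<otimes>\<^bsub>K\<^esub> eval_word K f w"
  by (simp add: eval_word_def)

locale presentation =
  fixes S :: "'a set" and R :: "('a group_word \<times> 'a group_word) set"
  assumes relations_over_generators: "R \<subseteq> lists (S \<times> UNIV) \<times> lists (S \<times> UNIV)"
begin

abbreviation cls :: "'a group_word \<Rightarrow> 'a group_word set" where
  "cls w \<equiv> pres_cong S R `` {w}"

lemma pres_cong_lists:
  assumes "(u, v) \<in> pres_cong S R"
  shows "u \<in> lists (S \<times> UNIV) \<and> v \<in> lists (S \<times> UNIV)"
  using assms relations_over_generators by induction auto

lemma equiv_pres_cong: "equiv (lists (S \<times> UNIV)) (pres_cong S R)"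
proof (rule equivI)
  show "pres_cong S R \<subseteq> lists (S \<times> UNIV) \<times> lists (S \<times> UNIV)"
    using pres_cong_lists by (simp add: subset_iff del: in_lists_conv_set)
  show "refl_on (lists (S \<times> UNIV)) (pres_cong S R)"
    by (rule refl_onI) (rule pres_cong.refl)
  show "Relation.sym (pres_cong S R)" by (auto intro: symI pres_cong.sym)
  show "Relation.trans (pres_cong S R)" by (auto intro: transI pres_cong.trans)
qed

lemma cls_eqI: "(u, v) \<in> pres_cong S R \<Longrightarrow> cls u = cls v"
  using equiv_pres_cong equiv_class_eq by metis

lemma carrier_presented_group:
  "carrier (presented_group S R) = cls ` lists (S \<times> UNIV)"
  by (auto simp: presented_group_def quotient_def)

lemma cls_closed: "w \<in> lists (S \<times> UNIV) \<Longrightarrow> cls w \<in> carrier (presented_group S R)"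
  by (auto simp: carrier_presented_group)

lemma one_presented_group: "\<one>\<^bsub>presented_group S R\<^esub> = cls []"
  by (simp add: presented_group_def)

lemma mult_cls:
  assumes "u \<in> lists (S \<times> UNIV)" "v \<in> lists (S \<times> UNIV)"
  shows "cls u \<otimes>\<^bsub>presented_group S R\<^esub> cls v = cls (u @ v)"
proof -
  have "cls (a @ b) = cls (u @ v)" if "a \<in> cls u" "b \<in> cls v" for a b
    using that by (intro cls_eqI pres_cong.append) (auto intro: pres_cong.sym)
  moreover have "u \<in> cls u" "v \<in> cls v" using assms by (auto intro: pres_cong.refl)
  ultimately have "(\<Union>a\<in>cls u. \<Union>b\<in>cls v. cls (a @ b)) = cls (u @ v)" by blast
  then show ?thesis by (simp add: presented_group_def)
qed

lemma formal_inverse_lists: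
  "w \<in> lists (S \<times> UNIV) \<Longrightarrow> formal_inverse w \<in> lists (S \<times> UNIV)"
  by (auto simp: formal_inverse_def)

lemma formal_inverse_cancels:
  assumes "w \<in> lists (S \<times> UNIV)"
  shows "(formal_inverse w @ w, []) \<in> pres_cong S R"
  using assms
proof (induction w)
  case Nil
  then show ?case by (auto simp: formal_inverse_def intro: pres_cong.refl)
next
  case (Cons a w)
  obtain x b where a: "a = (x, b)" by force
  have x: "x \<in> S" and w: "w \<in> lists (S \<times> UNIV)" using Cons.hyps a by simp_all
  have "([(x, \<not> b), (x, \<not> \<not> b)], []) \<in> pres_cong S R" by (rule pres_cong.cancel[OF x])
  then have "([(x, \<not> b), a] @ w, [] @ w) \<in> pres_cong S R"
    unfolding a not_not by (rule pres_cong.append[OF _ pres_cong.refl[OF w]])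
  then have "(formal_inverse w @ ([(x, \<not> b), a] @ w), formal_inverse w @ ([] @ w)) \<in> pres_cong S R"
    by (rule pres_cong.append[OF pres_cong.refl[OF formal_inverse_lists[OF w]]])
  moreover have "formal_inverse (a # w) @ a # w = formal_inverse w @ ([(x, \<not> b), a] @ w)"
    by (simp add: formal_inverse_def a)
  ultimately show ?case using Cons.IH by (simp add: pres_cong.trans)
qed

lemma group_presented_group: "group (presented_group S R)"
proof (rule groupI)
  fix x assume "x \<in> carrier (presented_group S R)"
  then obtain w where w: "x = cls w" "w \<in> lists (S \<times> UNIV)"
    by (auto simp: carrier_presented_group)
  show "\<exists>y\<in>carrier (presented_group S R). y \<otimes>\<^bsub>presented_group S R\<^esub> x = \<one>\<^bsub>presented_group S R\<^esub>"
  proof (rule bexI[of _ "cls (formal_inverse w)"])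
    show "cls (formal_inverse w) \<otimes>\<^bsub>presented_group S R\<^esub> x = \<one>\<^bsub>presented_group S R\<^esub>"
      unfolding w(1) mult_cls[OF formal_inverse_lists[OF w(2)] w(2)] one_presented_group
      by (rule cls_eqI[OF formal_inverse_cancels[OF w(2)]])
  qed (rule cls_closed[OF formal_inverse_lists[OF w(2)]])
next
  fix x y z
  assume "x \<in> carrier (presented_group S R)" "y \<in> carrier (presented_group S R)"
    "z \<in> carrier (presented_group S R)"
  then obtain u v w where "x = cls u" "u \<in> lists (S \<times> UNIV)" "y = cls v" "v \<in> lists (S \<times> UNIV)"
    "z = cls w" "w \<in> lists (S \<times> UNIV)"
    unfolding carrier_presented_group by (elim imageE)
  then show "x \<otimes>\<^bsub>presented_group S R\<^esub> y \<in> carrier (presented_group S R)"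
    and "x \<otimes>\<^bsub>presented_group S R\<^esub> y \<otimes>\<^bsub>presented_group S R\<^esub> z =
      x \<otimes>\<^bsub>presented_group S R\<^esub> (y \<otimes>\<^bsub>presented_group S R\<^esub> z)"
    and "\<one>\<^bsub>presented_group S R\<^esub> \<otimes>\<^bsub>presented_group S R\<^esub> x = x"
    by (simp_all add: mult_cls cls_closed one_presented_group lists.Nil del: in_lists_conv_set)
next
  show "\<one>\<^bsub>presented_group S R\<^esub> \<in> carrier (presented_group S R)"
    by (simp add: one_presented_group cls_closed)
qed

text \<open>The universal property of a presentation: evaluation of words respects the congruence as
  soon as it respects the relations.\<close>

lemma presented_group_universal:
  assumes "group K" and f: "\<And>x. x \<in> S \<Longrightarrow> f x \<in> carrier K"
    and rel: "\<And>u v. (u, v) \<in> R \<Longrightarrow> eval_word K f u = eval_word K f v"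
  obtains h where "h \<in> hom (presented_group S R) K" "\<And>x. x \<in> S \<Longrightarrow> h (cls [(x, True)]) = f x"
proof -
  interpret K: group K by fact
  have closed: "eval_word K f w \<in> carrier K" if "w \<in> lists (S \<times> UNIV)" for w
    using that f by (induction w) auto
  have app: "eval_word K f (u @ v) = eval_word K f u \<otimes>\<^bsub>K\<^esub> eval_word K f v"
    if "u \<in> lists (S \<times> UNIV)" "v \<in> lists (S \<times> UNIV)" for u v
    using that
  proof (induction u)
    case (Cons a u)
    obtain x b where "a = (x, b)" by force
    then show ?case using Cons f closed by (auto simp: K.m_assoc)
  qed (use closed in auto)
  have resp: "eval_word K f u = eval_word K f v" if "(u, v) \<in> pres_cong S R" for u v
    using that
  proof induction
    case (append u u' v v')
    then show ?case using app pres_cong_lists by metis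
  qed (use rel f in auto)
  define h where "h X = eval_word K f (SOME w. w \<in> X)" for X
  have h: "h (cls w) = eval_word K f w" if "w \<in> lists (S \<times> UNIV)" for w
  proof -
    have "w \<in> cls w" using that by (auto intro: pres_cong.refl)
    then have "(SOME w'. w' \<in> cls w) \<in> cls w" by (rule someI)
    then show ?thesis using resp[of w "SOME w'. w' \<in> cls w"] by (simp add: h_def)
  qed
  show thesis
  proof
    show "h \<in> hom (presented_group S R) K"
    proof (rule homI)
      fix x y
      assume "x \<in> carrier (presented_group S R)" "y \<in> carrier (presented_group S R)"
      then obtain u v where "x = cls u" "u \<in> lists (S \<times> UNIV)" "y = cls v" "v \<in> lists (S \<times> UNIV)"
        unfolding carrier_presented_group by (elim imageE)
      then show "h (x \<otimes>\<^bsub>presented_group S R\<^esub> y) = h x \<otimes>\<^bsub>K\<^esub> h y" and "h x \<in> carrier K"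
        by (simp_all add: mult_cls h app closed del: in_lists_conv_set)
    qed
    show "h (cls [(x, True)]) = f x" if "x \<in> S" for x
      using that f by (simp add: h)
  qed
qed

end

section \<open>Groups generated by involutions\<close>

text \<open>Involutions are their own inverses, so a group generated by them is generated as a monoid. This
  is expressed by the induction principle that it yields.\<close>

locale involution_generated_group = group +
  fixes I :: "'i set" and s :: "'i \<Rightarrow> 'a"
  assumes gen_closed: "k \<in> I \<Longrightarrow> s k \<in> carrier G"
    and gen_square: "k \<in> I \<Longrightarrow> s k \<otimes> s k = \<one>"
    and gen_induct [consumes 1, case_names one mult]:
      "x \<in> carrier G \<Longrightarrow> P \<one> \<Longrightarrow>
       (\<And>k y. k \<in> I \<Longrightarrow> y \<in> carrier G \<Longrightarrow> P y \<Longrightarrow> P (s k \<otimes> y)) \<Longrightarrow> P x"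
begin

lemma inv_gen: "k \<in> I \<Longrightarrow> inv (s k) = s k"
  using gen_closed gen_square inv_equality by blast

lemma homs_eq_on_generators:
  assumes "group K" "h \<in> hom G K" "h' \<in> hom G K"
    and gens: "\<And>k. k \<in> I \<Longrightarrow> h (s k) = h' (s k)" and "x \<in> carrier G"
  shows "h x = h' x"
  using assms(5)
proof (induction rule: gen_induct)
  case one
  show ?case using assms(1-3) hom_one is_group by metis
next
  case (mult k y)
  then show ?case using assms(2,3) gens gen_closed by (simp add: hom_mult)
qed

text \<open>The generators are their own inverses, so every element is a product of generators and
  conjugation by it is a composition of conjugations by generators.\<close>

lemma normal_if_gen_conj_closed:
  assumes N: "subgroup N G"
    and conj: "\<And>k x. k \<in> I \<Longrightarrow> x \<in> N \<Longrightarrow> s k \<otimes> x \<otimes> s k \<in> N"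
  shows "N \<lhd> G"
proof -
  have sub: "N \<subseteq> carrier G" using N by (rule subgroup.subset)
  have "\<forall>h\<in>N. x \<otimes> h \<otimes> inv x \<in> N" if "x \<in> carrier G" for x
    using that
  proof (induction rule: gen_induct)
    case one
    show ?case using sub by auto
  next
    case (mult k y)
    show ?case
    proof
      fix h assume h: "h \<in> N"
      have "s k \<otimes> (y \<otimes> h \<otimes> inv y) \<otimes> s k \<in> N" using mult h conj by auto
      moreover have "s k \<otimes> y \<otimes> h \<otimes> inv (s k \<otimes> y) = s k \<otimes> (y \<otimes> h \<otimes> inv y) \<otimes> s k"
        using mult.hyps h sub gen_closed by (auto simp: inv_mult_group m_assoc inv_gen)
      ultimately show "s k \<otimes> y \<otimes> h \<otimes> inv (s k \<otimes> y) \<in> N" by simp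
    qed
  qed
  then show ?thesis using N by (simp add: normal_inv_iff)
qed

text \<open>Modulo a normal subgroup, the elements that commute with a given one form a subgroup. So if the
  generators commute with each other, then every element commutes with each generator, and finally with
  every element.\<close>

lemma derived_subset_if_gens_commute:
  assumes "N \<lhd> G"
    and comm: "\<And>i j. i \<in> I \<Longrightarrow> j \<in> I \<Longrightarrow> s i \<otimes> s j \<otimes> s i \<otimes> s j \<in> N"
  shows "derived G (carrier G) \<subseteq> N"
proof -
  interpret N: normal N G by fact
  interpret Q: group "G Mod N" by (rule N.factorgroup_is_group)
  let ?q = "\<lambda>x. N #> x"
  have q: "?q x \<in> carrier (G Mod N)" if "x \<in> carrier G" for x
    using that by (auto simp: carrier_FactGroup)
  have qm: "?q (x \<otimes> y) = ?q x \<otimes>\<^bsub>G Mod N\<^esub> ?q y" if "x \<in> carrier G" "y \<in> carrier G" for x y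
    using that by (simp add: N.rcos_sum)
  have gens: "?q (s i) \<otimes>\<^bsub>G Mod N\<^esub> ?q (s j) = ?q (s j) \<otimes>\<^bsub>G Mod N\<^esub> ?q (s i)" if "i \<in> I" "j \<in> I" for i j
  proof -
    have c: "s i \<in> carrier G" "s j \<in> carrier G" using that gen_closed by auto
    have "s i \<otimes> s j = (s i \<otimes> s j \<otimes> s i \<otimes> s j) \<otimes> (s j \<otimes> s i)"
    proof -
      have "(s i \<otimes> s j \<otimes> s i \<otimes> s j) \<otimes> (s j \<otimes> s i) = s i \<otimes> s j \<otimes> s i \<otimes> (s j \<otimes> s j) \<otimes> s i"
        using c by (simp add: m_assoc)
      also have "\<dots> = s i \<otimes> s j \<otimes> (s i \<otimes> s i)"
        using c that gen_square by (simp add: m_assoc)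
      finally show ?thesis using c that gen_square by simp
    qed
    then have "?q (s i \<otimes> s j) = ?q (s i \<otimes> s j \<otimes> s i \<otimes> s j) \<otimes>\<^bsub>G Mod N\<^esub> ?q (s j \<otimes> s i)"
      using qm[of "s i \<otimes> s j \<otimes> s i \<otimes> s j" "s j \<otimes> s i"] c by simp
    moreover have "?q (s i \<otimes> s j \<otimes> s i \<otimes> s j) = \<one>\<^bsub>G Mod N\<^esub>"
      using comm[OF that] N.rcos_const by simp
    ultimately have "?q (s i \<otimes> s j) = ?q (s j \<otimes> s i)"
      using q[of "s j \<otimes> s i"] c by (metis Q.l_one m_closed)
    then show ?thesis using qm c by simp
  qed
  have one_gen: "?q x \<otimes>\<^bsub>G Mod N\<^esub> ?q (s j) = ?q (s j) \<otimes>\<^bsub>G Mod N\<^esub> ?q x"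
    if "x \<in> carrier G" "j \<in> I" for x j
    using that(1)
  proof (induction rule: gen_induct)
    case one
    show ?case using qm[of \<one> "s j"] qm[of "s j" \<one>] gen_closed[OF that(2)] by simp
  next
    case (mult k y)
    note c = q[OF gen_closed[OF mult(1)]] q[OF mult(2)] q[OF gen_closed[OF that(2)]]
    show ?case unfolding qm[OF gen_closed[OF mult(1)] mult(2)]
      using c gens[OF mult(1) that(2)] mult.IH by (metis Q.m_assoc)
  qed
  have all: "?q x \<otimes>\<^bsub>G Mod N\<^esub> ?q y = ?q y \<otimes>\<^bsub>G Mod N\<^esub> ?q x"
    if y: "y \<in> carrier G" and x: "x \<in> carrier G" for x y
    using y
  proof (induction rule: gen_induct)
    case one
    show ?case using qm[of \<one> x] qm[of x \<one>] x by simp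
  next
    case (mult k y)
    note c = q[OF gen_closed[OF mult(1)]] q[OF mult(2)] q[OF x]
    show ?case unfolding qm[OF gen_closed[OF mult(1)] mult(2)]
      using c one_gen[OF x mult(1)] mult.IH by (metis Q.m_assoc)
  qed
  have "x \<otimes> y \<otimes> inv x \<otimes> inv y \<in> N" if "x \<in> carrier G" "y \<in> carrier G" for x y
  proof -
    have "?q (x \<otimes> y) = ?q (y \<otimes> x)" using all that qm by simp
    then have "x \<otimes> y \<in> N #> (y \<otimes> x)" using that rcos_self[OF _ N.subgroup_axioms] by (metis m_closed)
    then obtain h where h: "h \<in> N" "x \<otimes> y = h \<otimes> (y \<otimes> x)" by (auto simp: r_coset_def)
    have "x \<otimes> y \<otimes> inv x \<otimes> inv y = (x \<otimes> y) \<otimes> inv (y \<otimes> x)"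
      using that by (simp add: inv_mult_group m_assoc)
    also have "\<dots> = h" using h that N.mem_carrier[OF h(1)] by (simp add: m_assoc)
    finally show ?thesis using h by simp
  qed
  then have "derived_set G (carrier G) \<subseteq> N" by auto
  then show ?thesis unfolding derived_def by (rule generate_subgroup_incl[OF _ N.is_subgroup])
qed

end

text \<open>The images of the generators are the unit vectors, and a vector over the field with two
  elements is the sum of the unit vectors in its support.\<close>

lemma (in involution_generated_group) Z2_product_epi:
  assumes "finite I"
    and ab: "ab \<in> hom G (product_group I (\<lambda>_. integer_mod_group 2))"
    and gens: "\<And>k. k \<in> I \<Longrightarrow> ab (s k) = (\<lambda>j\<in>I. if j = k then 1 else 0)"
  shows "ab \<in> epi G (product_group I (\<lambda>_. integer_mod_group 2))"
proof -
  let ?P = "product_group I (\<lambda>_. integer_mod_group 2)"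
  have part: "\<exists>x\<in>carrier G. ab x = (\<lambda>j\<in>I. if j \<in> J then f j else 0)"
    if f: "f \<in> carrier ?P" and J: "J \<subseteq> I" for f J
    using finite_subset[OF J \<open>finite I\<close>] J
  proof (induction J rule: finite_induct)
    case empty
    have "ab \<one> = \<one>\<^bsub>?P\<^esub>" using hom_one[OF ab is_group] by simp
    then show ?case by (intro bexI[of _ \<one>]) auto
  next
    case (insert k J)
    then obtain x where x: "x \<in> carrier G" "ab x = (\<lambda>j\<in>I. if j \<in> J then f j else 0)" by blast
    have k: "k \<in> I" using insert by simp
    have "f k = 0 \<or> f k = 1" using f k by (force simp: carrier_integer_mod_group PiE_iff)
    then show ?case
    proof
      assume "f k = 0"
      then have "ab x = (\<lambda>j\<in>I. if j \<in> insert k J then f j else 0)"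
        using x(2) by (auto simp: fun_eq_iff)
      then show ?thesis using x(1) by blast
    next
      assume 1: "f k = 1"
      have "ab (s k \<otimes> x) = ab (s k) \<otimes>\<^bsub>?P\<^esub> ab x"
        using hom_mult[OF ab gen_closed[OF k] x(1)] .
      also have "\<dots> = (\<lambda>j\<in>I. if j \<in> insert k J then f j else 0)"
        using f insert.hyps 1
        by (auto simp: gens[OF k] x(2) fun_eq_iff carrier_integer_mod_group PiE_iff)
      finally show ?thesis using gen_closed[OF k] x(1) by blast
    qed
  qed
  have "\<exists>x\<in>carrier G. ab x = f" if "f \<in> carrier ?P" for f
  proof -
    have "(\<lambda>j\<in>I. if j \<in> I then f j else 0) = f"
      using that by (auto simp: fun_eq_iff PiE_iff extensional_def)
    then show ?thesis using part[OF that, of I] by simp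
  qed
  then have "carrier ?P \<subseteq> ab ` carrier G" by blast
  moreover have "ab ` carrier G \<subseteq> carrier ?P" using ab by (auto simp: hom_def)
  ultimately show ?thesis using ab by (simp add: epi_def)
qed

text \<open>The commutator quotient receives a homomorphism from the elementary abelian group that is
  inverse to the map induced by \<open>ab\<close>; hence nothing outside the commutator subgroup dies.\<close>

lemma (in involution_generated_group) kernel_Z2_product:
  assumes "finite I"
    and ab: "ab \<in> hom G (product_group I (\<lambda>_. integer_mod_group 2))"
    and gens: "\<And>k. k \<in> I \<Longrightarrow> ab (s k) = (\<lambda>j\<in>I. if j = k then 1 else 0)"
  shows "kernel G (product_group I (\<lambda>_. integer_mod_group 2)) ab = derived G (carrier G)"
proof
  let ?P = "product_group I (\<lambda>_. integer_mod_group 2)"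
  let ?D = "derived G (carrier G)"
  have P: "comm_group ?P"
    by (rule group.group_comm_groupI) (auto simp: fun_eq_iff add.commute)
  interpret P: comm_group ?P by (rule P)
  interpret ab: group_hom G ?P ab by unfold_locales (rule ab)
  show "?D \<subseteq> kernel G ?P ab"
  proof -
    have "ab ` carrier G \<subseteq> carrier ?P" using ab by (auto simp: hom_def)
    then have "ab ` ?D = {\<one>\<^bsub>?P\<^esub>}"
      using ab.derived_img[OF subset_refl] P.derived_eq_singleton by metis
    then show ?thesis using derived_in_carrier[OF subset_refl] by (auto simp: kernel_def)
  qed
  interpret D: normal ?D G by (rule derived_self_is_normal)
  interpret Q: comm_group "G Mod ?D" by (rule derived_quot_is_comm_group)
  let ?q = "\<lambda>x. ?D #> x"
  have q: "?q x \<in> carrier (G Mod ?D)" if "x \<in> carrier G" for x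
    using that by (auto simp: carrier_FactGroup)
  have q_hom: "?q \<in> hom G (G Mod ?D)" by (rule D.r_coset_hom_Mod)
  have sq: "?q (s k) \<otimes>\<^bsub>G Mod ?D\<^esub> ?q (s k) = \<one>\<^bsub>G Mod ?D\<^esub>" if "k \<in> I" for k
    using hom_mult[OF q_hom gen_closed[OF that] gen_closed[OF that]] gen_square[OF that]
      hom_one[OF q_hom is_group Q.is_group] by metis
  let ?t = "\<lambda>(f :: 'i \<Rightarrow> int) k. if f k = 1 then ?q (s k) else \<one>\<^bsub>G Mod ?D\<^esub>"
  define \<theta> where "\<theta> f = finprod (G Mod ?D) (?t f) I" for f
  have t: "?t f \<in> I \<rightarrow> carrier (G Mod ?D)" for f
    using q gen_closed by (auto simp del: mult_FactGroup one_FactGroup)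
  have \<theta>_hom: "\<theta> \<in> hom ?P (G Mod ?D)"
  proof (rule homI)
    show "\<theta> f \<in> carrier (G Mod ?D)" for f unfolding \<theta>_def using t by (rule Q.finprod_closed)
    fix f g assume fg: "f \<in> carrier ?P" "g \<in> carrier ?P"
    have "\<theta> f \<otimes>\<^bsub>G Mod ?D\<^esub> \<theta> g = finprod (G Mod ?D) (\<lambda>k. ?t f k \<otimes>\<^bsub>G Mod ?D\<^esub> ?t g k) I"
      unfolding \<theta>_def by (rule Q.finprod_multf[symmetric, OF t t])
    also have "\<dots> = \<theta> (f \<otimes>\<^bsub>?P\<^esub> g)" unfolding \<theta>_def
    proof (rule Q.finprod_cong'[OF HOL.refl t])
      fix k assume k: "k \<in> I"
      then have "f k = 0 \<or> f k = 1" "g k = 0 \<or> g k = 1"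
        using fg by (force simp: carrier_integer_mod_group PiE_iff)+
      then show "?t f k \<otimes>\<^bsub>G Mod ?D\<^esub> ?t g k = ?t (f \<otimes>\<^bsub>?P\<^esub> g) k"
        using k sq[OF k] q[OF gen_closed[OF k]]
        by (elim disjE) (simp_all del: mult_FactGroup one_FactGroup)
    qed
    finally show "\<theta> (f \<otimes>\<^bsub>?P\<^esub> g) = \<theta> f \<otimes>\<^bsub>G Mod ?D\<^esub> \<theta> g" by (rule HOL.sym)
  qed
  have \<theta>_ab: "\<theta> (ab x) = ?q x" if "x \<in> carrier G" for x
  proof -
    have "(\<theta> \<circ> ab) x = ?q x"
    proof (rule homs_eq_on_generators[where h' = ?q, OF Q.is_group Group.hom_compose[OF ab \<theta>_hom] q_hom _ that])
      fix k assume k: "k \<in> I"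
      have "\<theta> (ab (s k)) = finprod (G Mod ?D) (\<lambda>j. if j = k then ?q (s j) else \<one>\<^bsub>G Mod ?D\<^esub>) I"
        unfolding \<theta>_def gens[OF k]
        by (rule Q.finprod_cong') (use q gen_closed k in \<open>auto simp del: mult_FactGroup one_FactGroup\<close>)
      also have "\<dots> = ?q (s k)"
        by (rule Q.finprod_singleton_swap[OF k \<open>finite I\<close>]) (use q gen_closed in auto)
      finally show "(\<theta> \<circ> ab) (s k) = ?q (s k)" by simp
    qed
    then show ?thesis by simp
  qed
  show "kernel G ?P ab \<subseteq> ?D"
  proof
    fix x assume "x \<in> kernel G ?P ab"
    then have x: "x \<in> carrier G" "ab x = \<one>\<^bsub>?P\<^esub>" by (auto simp: kernel_def)
    have "?q x = \<one>\<^bsub>G Mod ?D\<^esub>"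
      using \<theta>_ab[OF x(1)] hom_one[OF \<theta>_hom P.is_group Q.is_group] x(2) by simp
    then have "?D #> x = ?D" by simp
    then show "x \<in> ?D" using rcos_self[OF x(1) D.subgroup_axioms] by simp
  qed
qed

section \<open>Twin groups\<close>

lemma twin_presentation: "presentation {1..<n} (twin_relations n)"
  by unfold_locales (auto simp: twin_relations_def)

text \<open>The relation \<open>s\<^sub>k\<^sup>2 = 1\<close> identifies the two letters of each generator, so that induction over
  words becomes induction over products of the generators themselves.\<close>

lemma twin_group_involutions:
  "involution_generated_group (twin_group n) {1..<n} (twin_gen n)"
proof -
  interpret presentation "{1..<n}" "twin_relations n" by (rule twin_presentation)
  interpret T: group "twin_group n" unfolding twin_group_def by (rule group_presented_group)
  let ?w = "lists ({1..<n} \<times> (UNIV :: bool set))"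
  have letter: "[(k, b)] \<in> ?w" if "k \<in> {1..<n}" for k b using that by simp
  have mult: "cls u \<otimes>\<^bsub>twin_group n\<^esub> cls v = cls (u @ v)" if "u \<in> ?w" "v \<in> ?w" for u v
    unfolding twin_group_def by (rule mult_cls[OF that])
  have one: "\<one>\<^bsub>twin_group n\<^esub> = cls []" unfolding twin_group_def by (rule one_presented_group)
  have closed: "twin_gen n k \<in> carrier (twin_group n)" if "k \<in> {1..<n}" for k
    unfolding twin_gen_def twin_group_def by (rule cls_closed[OF letter[OF that]])
  have square: "twin_gen n k \<otimes>\<^bsub>twin_group n\<^esub> twin_gen n k = \<one>\<^bsub>twin_group n\<^esub>" if "k \<in> {1..<n}" for k
  proof -
    have "cls ([(k, True)] @ [(k, True)]) = cls []"
      by (rule cls_eqI[OF pres_cong.relation]) (use that in \<open>auto simp: twin_relations_def\<close>)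
    then show ?thesis unfolding twin_gen_def one mult[OF letter[OF that] letter[OF that]] .
  qed
  have letters: "cls [(k, b)] = twin_gen n k" if k: "k \<in> {1..<n}" for k b
  proof (cases b)
    case False
    have "cls ([(k, False)] @ [(k, \<not> False)]) = cls []"
      using cls_eqI[OF pres_cong.cancel[OF k, of False]] by simp
    then have "cls [(k, False)] \<otimes>\<^bsub>twin_group n\<^esub> twin_gen n k = \<one>\<^bsub>twin_group n\<^esub>"
      using mult[OF letter[OF k] letter[OF k]] by (simp add: twin_gen_def one)
    then have "cls [(k, False)] = inv\<^bsub>twin_group n\<^esub> twin_gen n k"
      using T.inv_equality closed[OF k] cls_closed[OF letter[OF k]]
      by (simp add: twin_group_def)
    moreover have "twin_gen n k = inv\<^bsub>twin_group n\<^esub> twin_gen n k"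
      using T.inv_equality[OF square[OF k] closed[OF k] closed[OF k]] by simp
    ultimately show ?thesis using False by simp
  qed (simp add: twin_gen_def)
  show ?thesis
  proof
    fix x :: "nat group_word set" and P
    assume x: "x \<in> carrier (twin_group n)" and 1: "P \<one>\<^bsub>twin_group n\<^esub>"
      and step: "\<And>k y. k \<in> {1..<n} \<Longrightarrow> y \<in> carrier (twin_group n) \<Longrightarrow> P y \<Longrightarrow>
        P (twin_gen n k \<otimes>\<^bsub>twin_group n\<^esub> y)"
    obtain w where w: "w \<in> ?w" "x = cls w"
      using x unfolding twin_group_def carrier_presented_group by (elim imageE)
    have "P (cls w)" using w(1)
    proof induction
      case Nil
      then show ?case using 1 by (simp add: one)
    next
      case (Cons a w)
      obtain k b where a: "a = (k, b)" by force
      then have k: "k \<in> {1..<n}" using Cons.hyps by simp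
      have "P (twin_gen n k \<otimes>\<^bsub>twin_group n\<^esub> cls w)"
        using step[OF k _ Cons.IH] cls_closed[OF Cons.hyps(2)] by (simp add: twin_group_def)
      then show ?case
        using mult[OF letter[OF k] Cons.hyps(2)] letters[OF k] a by simp
    qed
    then show "P x" using w(2) by simp
  qed (fact closed square)+
qed

lemma twin_gens_commute:
  assumes "i \<in> {1..<n}" "j \<in> {1..<n}" "\<bar>int i - int j\<bar> \<ge> 2"
  shows "twin_gen n i \<otimes>\<^bsub>twin_group n\<^esub> twin_gen n j = twin_gen n j \<otimes>\<^bsub>twin_group n\<^esub> twin_gen n i"
proof -
  interpret presentation "{1..<n}" "twin_relations n" by (rule twin_presentation)
  have "cls ([(i, True)] @ [(j, True)]) = cls ([(j, True)] @ [(i, True)])"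
    by (rule cls_eqI[OF pres_cong.relation]) (use assms in \<open>simp add: twin_relations_def\<close>)
  moreover have "[(i, True)] \<in> lists ({1..<n} \<times> UNIV)" "[(j, True)] \<in> lists ({1..<n} \<times> UNIV)"
    using assms by auto
  ultimately show ?thesis by (simp only: twin_gen_def twin_group_def mult_cls)
qed

lemma twin_group_universal:
  assumes "group K" and f: "\<And>k. k \<in> {1..<n} \<Longrightarrow> f k \<in> carrier K"
    and sq: "\<And>k. k \<in> {1..<n} \<Longrightarrow> f k \<otimes>\<^bsub>K\<^esub> f k = \<one>\<^bsub>K\<^esub>"
    and comm: "\<And>i j. i \<in> {1..<n} \<Longrightarrow> j \<in> {1..<n} \<Longrightarrow> \<bar>int i - int j\<bar> \<ge> 2 \<Longrightarrow>
      f i \<otimes>\<^bsub>K\<^esub> f j = f j \<otimes>\<^bsub>K\<^esub> f i"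
  shows "\<exists>h\<in>hom (twin_group n) K. \<forall>k\<in>{1..<n}. h (twin_gen n k) = f k"
proof -
  interpret presentation "{1..<n}" "twin_relations n" by (rule twin_presentation)
  interpret K: group K by fact
  show ?thesis
  proof (rule presented_group_universal[OF \<open>group K\<close> f])
    fix u v assume "(u, v) \<in> twin_relations n"
    then show "eval_word K f u = eval_word K f v"
      using f sq comm by (auto simp: twin_relations_def)
  next
    fix h assume "h \<in> hom (presented_group {1..<n} (twin_relations n)) K"
      "\<And>k. k \<in> {1..<n} \<Longrightarrow> h (cls [(k, True)]) = f k"
    then show ?thesis by (intro bexI[of _ h]) (simp_all add: twin_group_def twin_gen_def)
  qed
qed

lemma Z2_power_eq: "Z2_power (n - 1) = product_group {1..<n} (\<lambda>_. integer_mod_group 2)"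
proof -
  have "{1..n - 1} = {1..<n}" by auto
  then show ?thesis by (simp add: Z2_power_def)
qed

lemma twin_group_to_Z2_power:
  obtains ab where "ab \<in> hom (twin_group n) (Z2_power (n - 1))"
    "\<And>k. k \<in> {1..<n} \<Longrightarrow> ab (twin_gen n k) = (\<lambda>j\<in>{1..<n}. if j = k then 1 else 0)"
proof -
  let ?P = "product_group {1..<n} (\<lambda>_. integer_mod_group 2)"
  let ?f = "\<lambda>k. \<lambda>j\<in>{1..<n}. if j = k then (1::int) else 0"
  have P: "group ?P" by simp
  have f: "?f k \<in> carrier ?P" and sq: "?f k \<otimes>\<^bsub>?P\<^esub> ?f k = \<one>\<^bsub>?P\<^esub>"
    and comm: "?f k \<otimes>\<^bsub>?P\<^esub> ?f l = ?f l \<otimes>\<^bsub>?P\<^esub> ?f k" for k l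
    by (auto simp: carrier_integer_mod_group fun_eq_iff)
  have "\<exists>ab\<in>hom (twin_group n) ?P. \<forall>k\<in>{1..<n}. ab (twin_gen n k) = ?f k"
    by (rule twin_group_universal[OF P f sq comm])
  then obtain ab where ab: "ab \<in> hom (twin_group n) ?P"
    "\<And>k. k \<in> {1..<n} \<Longrightarrow> ab (twin_gen n k) = ?f k"
    by (elim bexE) (rule that, auto)
  show thesis by (rule that[of ab]) (use ab in \<open>simp_all only: Z2_power_eq\<close>)
qed

section \<open>Metabelian quotients of the twin group\<close>

text \<open>The model is the quotient of the twin group by its second commutator subgroup. The aim is to
  generate its commutator subgroup by \<open>2n - 5\<close> elements.\<close>

locale metabelian_twin = involution_generated_group G "{1..<n}" s
  for G (structure) and n :: nat and s :: "nat \<Rightarrow> 'a" +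
  assumes gens_commute:
      "i \<in> {1..<n} \<Longrightarrow> j \<in> {1..<n} \<Longrightarrow> \<bar>int i - int j\<bar> \<ge> 2 \<Longrightarrow> s i \<otimes> s j = s j \<otimes> s i"
    and derived_commute:
      "a \<in> derived G (carrier G) \<Longrightarrow> b \<in> derived G (carrier G) \<Longrightarrow> a \<otimes> b = b \<otimes> a"
begin

abbreviation D where "D \<equiv> derived G (carrier G)"
abbreviation A where "A \<equiv> G\<lparr>carrier := D\<rparr>"

text \<open>This is conjugation by the involution \<open>s k\<close>.\<close>

definition gconj :: "nat \<Rightarrow> 'a \<Rightarrow> 'a" where
  "gconj k x = s k \<otimes> x \<otimes> s k"

definition gen_comm :: "nat \<Rightarrow> 'a" where
  "gen_comm i = s i \<otimes> s (i + 1) \<otimes> s i \<otimes> s (i + 1)"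

text \<open>If the commutator subgroup is written additively, as a module over the group ring, then this is
  \<open>(1 - s\<^sub>i\<^sub>+\<^sub>2) gen_comm i\<close>. Compared with the conjugate \<open>s\<^sub>i\<^sub>+\<^sub>2 gen_comm i\<close> itself it has the
  advantage that every generator maps it to itself or to its inverse.\<close>

definition twisted_comm :: "nat \<Rightarrow> 'a" where
  "twisted_comm i = gen_comm i \<otimes> inv (gconj (i + 2) (gen_comm i))"

text \<open>The two families are interleaved, so that the element with index \<open>m\<close> belongs to the coordinate
  \<open>m\<close> introduced below and the matrix of translations is almost diagonal.\<close>

definition basis :: "nat \<Rightarrow> 'a" where
  "basis m = (if even m then gen_comm (m div 2 + 1) else twisted_comm (m div 2 + 1))"

lemma D_normal: "D \<lhd> G"
  by (rule derived_self_is_normal)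

lemma D_subgroup: "subgroup D G"
  by (rule normal_imp_subgroup[OF D_normal])

lemmas D_carrier = subgroup.mem_carrier[OF D_subgroup]
lemmas D_mult_closed = subgroup.m_closed[OF D_subgroup]
lemmas D_inv_closed = subgroup.m_inv_closed[OF D_subgroup]

lemma cancel_gen: "k \<in> {1..<n} \<Longrightarrow> x \<in> carrier G \<Longrightarrow> s k \<otimes> (s k \<otimes> x) = x"
  using gen_closed gen_square by (simp flip: m_assoc)

lemma gen_commutator_in_D:
  assumes "x \<in> carrier G" "y \<in> carrier G" "inv x = x" "inv y = y"
  shows "x \<otimes> y \<otimes> x \<otimes> y \<in> D"
proof -
  have "x \<otimes> y \<otimes> inv x \<otimes> inv y \<in> derived_set G (carrier G)" using assms(1,2) by blast
  then have "x \<otimes> y \<otimes> inv x \<otimes> inv y \<in> D" unfolding derived_def by (rule generate.incl)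
  then show ?thesis by (simp only: assms(3,4))
qed

lemma gconj_closed: "k \<in> {1..<n} \<Longrightarrow> x \<in> D \<Longrightarrow> gconj k x \<in> D"
  using normal.inv_op_closed2[OF D_normal gen_closed, of k x] inv_gen[of k] by (simp add: gconj_def)

lemma gconj_mult:
  assumes "k \<in> {1..<n}" "x \<in> D" "y \<in> D"
  shows "gconj k (x \<otimes> y) = gconj k x \<otimes> gconj k y"
  using gen_closed[OF assms(1)] D_carrier[OF assms(2)] D_carrier[OF assms(3)] assms(1)
  by (simp add: gconj_def m_assoc cancel_gen)

lemma gconj_inv:
  assumes "k \<in> {1..<n}" "x \<in> D"
  shows "gconj k (inv x) = inv (gconj k x)"
  using gen_closed[OF assms(1)] D_carrier[OF assms(2)] assms(1)
  by (simp add: gconj_def inv_mult_group inv_gen m_assoc)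

lemma gconj_cj:
  assumes "k \<in> {1..<n}" "x \<in> D"
  shows "gconj k (gconj k x) = x"
  using gen_closed[OF assms(1)] D_carrier[OF assms(2)] assms(1)
  by (simp add: gconj_def m_assoc cancel_gen gen_square)

text \<open>The two sides differ by conjugation with a commutator of generators. It lies in the commutator
  subgroup, which is abelian, and therefore acts trivially there.\<close>

lemma gconj_commute:
  assumes "j \<in> {1..<n}" "k \<in> {1..<n}" "x \<in> D"
  shows "gconj j (gconj k x) = gconj k (gconj j x)"
proof -
  note c = gen_closed[OF assms(1)] gen_closed[OF assms(2)] D_carrier[OF assms(3)]
  let ?w = "s j \<otimes> s k \<otimes> s j \<otimes> s k"
  have w: "?w \<in> D" using c assms inv_gen by (intro gen_commutator_in_D) auto
  have y: "gconj k (gconj j x) \<in> D" using assms gconj_closed by simp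
  have "gconj j (gconj k x) = ?w \<otimes> gconj k (gconj j x) \<otimes> inv ?w"
    using c assms(1,2) by (simp add: gconj_def m_assoc inv_mult_group inv_gen cancel_gen)
  also have "\<dots> = gconj k (gconj j x) \<otimes> ?w \<otimes> inv ?w"
    using derived_commute[OF w y] by simp
  also have "\<dots> = gconj k (gconj j x)"
    using D_carrier[OF w] D_carrier[OF y] by (simp add: m_assoc)
  finally show ?thesis .
qed

lemma gen_comm_in_D: "1 \<le> i \<Longrightarrow> i + 1 < n \<Longrightarrow> gen_comm i \<in> D"
  unfolding gen_comm_def using gen_closed inv_gen by (intro gen_commutator_in_D) auto

lemma twisted_comm_in_D: "1 \<le> i \<Longrightarrow> i + 2 < n \<Longrightarrow> twisted_comm i \<in> D"
  unfolding twisted_comm_def using gen_comm_in_D[of i] gconj_closed[of "i + 2" "gen_comm i"]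
  by (intro D_mult_closed D_inv_closed) auto

lemma basis_in_D: "m < 2 * n - 5 \<Longrightarrow> basis m \<in> D"
  unfolding basis_def using gen_comm_in_D twisted_comm_in_D by (auto elim!: evenE oddE)

lemma gconj_gen_comm_left:
  assumes "1 \<le> i" "i + 1 < n"
  shows "gconj i (gen_comm i) = inv (gen_comm i)"
  using assms gen_closed[of i] gen_closed[of "Suc i"]
  by (simp add: gconj_def gen_comm_def m_assoc inv_mult_group inv_gen cancel_gen)

lemma gconj_gen_comm_right:
  assumes "1 \<le> i" "i + 1 < n"
  shows "gconj (i + 1) (gen_comm i) = inv (gen_comm i)"
  using assms gen_closed[of i] gen_closed[of "Suc i"] gen_square[of "Suc i"]
  by (simp add: gconj_def gen_comm_def m_assoc inv_mult_group inv_gen cancel_gen)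

lemma gconj_gen_comm_far:
  assumes "1 \<le> i" "i + 1 < n" "k \<in> {1..<n}" "k + 1 < i \<or> i + 2 < k"
  shows "gconj k (gen_comm i) = gen_comm i"
proof -
  have c: "s i \<in> carrier G" "s (i + 1) \<in> carrier G" "s k \<in> carrier G"
    using assms gen_closed by auto
  have a: "s k \<otimes> s i = s i \<otimes> s k" and b: "s k \<otimes> s (i + 1) = s (i + 1) \<otimes> s k"
    using assms by (auto intro!: gens_commute)
  have a': "s k \<otimes> (s i \<otimes> x) = s i \<otimes> (s k \<otimes> x)" if "x \<in> carrier G" for x
    using a c that by (metis m_assoc)
  have b': "s k \<otimes> (s (i + 1) \<otimes> x) = s (i + 1) \<otimes> (s k \<otimes> x)" if "x \<in> carrier G" for x
    using b c that by (metis m_assoc)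
  show ?thesis
    using c assms(3) gen_square[OF assms(3)] unfolding gconj_def gen_comm_def
    by (simp add: m_assoc a' b' del: One_nat_def add_Suc_right)
qed

text \<open>The commutators of \<open>s\<^sub>i s\<^sub>i\<^sub>+\<^sub>2 = s\<^sub>i\<^sub>+\<^sub>2 s\<^sub>i\<close> with \<open>s\<^sub>i\<^sub>+\<^sub>1\<close> can be expanded in two ways. Comparing
  the two expansions shows that twisting the commutator \<open>gen_comm i\<close> by \<open>s\<^sub>i\<^sub>+\<^sub>2\<close> and twisting
  \<open>gen_comm (i + 1)\<close> by \<open>s\<^sub>i\<close> give inverse elements.\<close>

lemma twisted_comm_eq:
  assumes "1 \<le> i" "i + 2 < n"
  shows "twisted_comm i = gconj i (gen_comm (i + 1)) \<otimes> inv (gen_comm (i + 1))"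
proof -
  define a b c where "a = s i" and "b = s (i + 1)" and "c = s (i + 2)"
  have cl: "a \<in> carrier G" "b \<in> carrier G" "c \<in> carrier G"
    using assms gen_closed by (auto simp: a_def b_def c_def)
  have sq: "a \<otimes> a = \<one>" "b \<otimes> b = \<one>" "c \<otimes> c = \<one>"
    using assms gen_square by (auto simp: a_def b_def c_def)
  have canc: "a \<otimes> (a \<otimes> x) = x" "b \<otimes> (b \<otimes> x) = x" "c \<otimes> (c \<otimes> x) = x" if "x \<in> carrier G" for x
    using sq cl that by (metis m_assoc l_one)+
  have inv: "inv a = a" "inv b = b" "inv c = c"
    using assms inv_gen by (auto simp: a_def b_def c_def)
  have ca: "c \<otimes> a = a \<otimes> c" using assms gens_commute by (auto simp: a_def c_def)
  have ca': "c \<otimes> (a \<otimes> x) = a \<otimes> (c \<otimes> x)" if "x \<in> carrier G" for x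
    using ca cl that by (metis m_assoc)
  define x y where "x = gen_comm i" and "y = gen_comm (i + 1)"
  have x: "x = a \<otimes> b \<otimes> a \<otimes> b" and y: "y = b \<otimes> c \<otimes> b \<otimes> c"
    by (simp_all add: x_def y_def gen_comm_def a_def b_def c_def)
  have D: "x \<in> D" "y \<in> D" "gconj (i + 2) x \<in> D" "gconj i y \<in> D"
    using assms gen_comm_in_D gconj_closed by (auto simp: x_def y_def)
  note Dc = D[THEN D_carrier]
  have cja: "gconj i z = a \<otimes> z \<otimes> a" and cjc: "gconj (i + 2) z = c \<otimes> z \<otimes> c" for z
    by (simp_all only: gconj_def a_def c_def)
  \<comment> \<open>Both of the following products are the commutator \<open>(ac)b(ac)b\<close>.\<close>
  have "inv (gconj i y) \<otimes> x = a \<otimes> c \<otimes> b \<otimes> c \<otimes> a \<otimes> b"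
    unfolding cja x y using cl by (simp add: inv_mult_group inv m_assoc canc)
  moreover have "gconj (i + 2) x \<otimes> inv y = a \<otimes> c \<otimes> b \<otimes> c \<otimes> a \<otimes> b"
    unfolding cjc x y using cl by (simp add: inv_mult_group inv m_assoc canc ca ca')
  ultimately have "inv (gconj i y) \<otimes> x = gconj (i + 2) x \<otimes> inv y" by simp
  then have "gconj i y \<otimes> (inv (gconj i y) \<otimes> x) = gconj i y \<otimes> (inv y \<otimes> gconj (i + 2) x)"
    using derived_commute[OF D(3) D_inv_closed[OF D(2)]] by simp
  then have "x = gconj i y \<otimes> inv y \<otimes> gconj (i + 2) x"
    using Dc by (simp flip: m_assoc)
  then have "x \<otimes> inv (gconj (i + 2) x) = gconj i y \<otimes> inv y \<otimes> gconj (i + 2) x \<otimes> inv (gconj (i + 2) x)"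
    by (rule arg_cong[where f = "\<lambda>z. z \<otimes> inv (gconj (i + 2) x)"])
  also have "\<dots> = gconj i y \<otimes> inv y"
    using Dc by (simp add: m_assoc)
  finally show ?thesis by (simp add: twisted_comm_def x_def y_def)
qed

text \<open>The conjugates of \<open>gen_comm i\<close> by the two generators adjacent to its own are no new elements:
  they are expressed by the two descriptions of the twisted commutators.\<close>

lemma gconj_gen_comm_next:
  assumes "1 \<le> i" "i + 2 < n"
  shows "gconj (i + 2) (gen_comm i) = gen_comm i \<otimes> inv (twisted_comm i)"
proof -
  have D: "gen_comm i \<in> D" "gconj (i + 2) (gen_comm i) \<in> D" using assms gen_comm_in_D gconj_closed by auto
  note Dc = D[THEN D_carrier]
  have "gen_comm i \<otimes> inv (twisted_comm i) =
      gen_comm i \<otimes> (gconj (i + 2) (gen_comm i) \<otimes> inv (gen_comm i))"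
    using Dc by (simp add: twisted_comm_def inv_mult_group)
  also have "\<dots> = gen_comm i \<otimes> (inv (gen_comm i) \<otimes> gconj (i + 2) (gen_comm i))"
    using derived_commute[OF D(2) D_inv_closed[OF D(1)]] by simp
  finally show ?thesis using Dc by (simp flip: m_assoc)
qed

lemma gconj_gen_comm_prev:
  assumes "2 \<le> i" "i + 1 < n"
  shows "gconj (i - 1) (gen_comm i) = gen_comm i \<otimes> twisted_comm (i - 1)"
proof -
  have D: "gen_comm i \<in> D" "gconj (i - 1) (gen_comm i) \<in> D"
    using assms gen_comm_in_D[of i] by (auto intro!: gconj_closed)
  have "twisted_comm (i - 1) = gconj (i - 1) (gen_comm i) \<otimes> inv (gen_comm i)"
    using twisted_comm_eq[of "i - 1"] assms by simp
  then have "gen_comm i \<otimes> twisted_comm (i - 1) =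
      gconj (i - 1) (gen_comm i) \<otimes> inv (gen_comm i) \<otimes> gen_comm i"
    using derived_commute[OF D(1) D_mult_closed[OF D(2) D_inv_closed[OF D(1)]]] by simp
  then show ?thesis using D[THEN D_carrier] by (simp add: m_assoc)
qed

text \<open>Conjugations by generators commute on the commutator subgroup, so a conjugation can be moved
  inside the twist. For \<open>k \<ge> i\<close> it then meets \<open>gen_comm i\<close>, whose conjugates are known. For \<open>k < i\<close> the
  second description of \<open>twisted_comm i\<close> is used: there it meets \<open>gen_comm (i + 1)\<close>, with which
  \<open>s\<^sub>k\<close> commutes.\<close>

lemma gconj_twisted_comm:
  assumes i: "1 \<le> i" "i + 2 < n" and k: "k \<in> {1..<n}"
  shows "gconj k (twisted_comm i) =
    (if k \<in> {i, i + 1, i + 2} then inv (twisted_comm i) else twisted_comm i)"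
proof -
  let ?x = "gen_comm i" and ?y = "gen_comm (i + 1)"
  have D: "?x \<in> D" "?y \<in> D" "gconj (i + 2) ?x \<in> D" "gconj i ?y \<in> D"
    using i gen_comm_in_D gconj_closed by auto
  have I: "i \<in> {1..<n}" "i + 1 \<in> {1..<n}" "i + 2 \<in> {1..<n}" using i by auto
  have inv_tw: "inv (twisted_comm i) = inv ?x \<otimes> gconj (i + 2) ?x"
    using D[THEN D_carrier] derived_commute[OF D(3) D_inv_closed[OF D(1)]]
    by (simp add: twisted_comm_def inv_mult_group)
  have first: "gconj k (twisted_comm i) = gconj k ?x \<otimes> inv (gconj (i + 2) (gconj k ?x))"
    unfolding twisted_comm_def gconj_commute[OF I(3) k D(1)] gconj_mult[OF k D(1) D_inv_closed[OF D(3)]]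
      gconj_inv[OF k D(3)] by (rule HOL.refl)
  have second: "gconj k (twisted_comm i) = gconj i (gconj k ?y) \<otimes> inv (gconj k ?y)"
    unfolding twisted_comm_eq[OF i] gconj_commute[OF I(1) k D(2)] gconj_mult[OF k D(4) D_inv_closed[OF D(2)]]
      gconj_inv[OF k D(2)] by (rule HOL.refl)
  consider "k = i \<or> k = i + 1" | "k = i + 2" | "i + 2 < k" | "k + 1 < i + 1" using k by linarith
  then show ?thesis
  proof cases
    case 1
    then have "gconj k ?x = inv ?x" using gconj_gen_comm_left gconj_gen_comm_right i by auto
    then have "gconj k (twisted_comm i) = inv ?x \<otimes> gconj (i + 2) ?x"
      using first D I D[THEN D_carrier] by (simp add: gconj_inv)
    then show ?thesis using 1 inv_tw by auto
  next
    case 2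
    then have "gconj k (twisted_comm i) = gconj (i + 2) ?x \<otimes> inv ?x"
      using first D I by (simp add: gconj_cj)
    then show ?thesis using 2 inv_tw derived_commute[OF D(3) D_inv_closed[OF D(1)]] by simp
  next
    case 3
    then have "gconj k ?x = ?x" using gconj_gen_comm_far i k by simp
    then show ?thesis using first 3 by (simp add: twisted_comm_def)
  next
    case 4
    then have "gconj k ?y = ?y" using gconj_gen_comm_far[of "i + 1" k] i k by simp
    then show ?thesis using second 4 twisted_comm_eq[OF i] by simp
  qed
qed

text \<open>By the formulas above the subgroup generated by \<open>basis\<close> is stable under conjugation, and
  modulo it the generators commute. Hence it contains all commutators.\<close>

lemma D_eq_generate_basis: "D = generate G (basis ` {..<2 * n - 5})"
proof
  let ?B = "basis ` {..<2 * n - 5}"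
  let ?N = "generate G ?B"
  have BD: "?B \<subseteq> D" using basis_in_D by auto
  then have B: "?B \<subseteq> carrier G" using subgroup.subset[OF D_subgroup] by blast
  have N: "subgroup ?N G" by (rule generate_is_subgroup[OF B])
  show ND: "?N \<subseteq> D" by (rule generate_subgroup_incl[OF BD D_subgroup])
  have x: "gen_comm i \<in> ?N" if "1 \<le> i" "i + 1 < n" for i
  proof -
    have "gen_comm i = basis (2 * (i - 1))" using that by (simp add: basis_def)
    moreover have "2 * (i - 1) < 2 * n - 5" using that by linarith
    ultimately show ?thesis using generate.incl[of "gen_comm i" ?B] by blast
  qed
  have e: "twisted_comm i \<in> ?N" if "1 \<le> i" "i + 2 < n" for i
  proof -
    have "twisted_comm i = basis (2 * (i - 1) + 1)" using that by (simp add: basis_def)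
    moreover have "2 * (i - 1) + 1 < 2 * n - 5" using that by linarith
    ultimately show ?thesis using generate.incl[of "twisted_comm i" ?B] by blast
  qed
  note Ncl = subgroup.m_closed[OF N] subgroup.m_inv_closed[OF N]
  have cx: "gconj k (gen_comm i) \<in> ?N" if "1 \<le> i" "i + 1 < n" "k \<in> {1..<n}" for i k
  proof -
    consider "k = i" | "k = i + 1" | "k = i + 2" | "k + 1 = i" | "k + 1 < i \<or> i + 2 < k" by linarith
    then show ?thesis
    proof cases
      case 1 then show ?thesis using gconj_gen_comm_left x Ncl that by simp
    next
      case 2 then show ?thesis using gconj_gen_comm_right[of i] x Ncl that by simp
    next
      case 3 then show ?thesis using gconj_gen_comm_next[of i] x e Ncl that by simp
    next
      case 4 then show ?thesis using gconj_gen_comm_prev[of i] x e Ncl that by auto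
    next
      case 5 then show ?thesis using gconj_gen_comm_far[of i k] x that by simp
    qed
  qed
  have cB: "gconj k b \<in> ?N" if b: "b \<in> ?B" and k: "k \<in> {1..<n}" for k b
  proof -
    obtain m where m: "m < 2 * n - 5" "b = basis m" using b by auto
    show ?thesis
    proof (cases "even m")
      case True
      then show ?thesis using m cx[of "m div 2 + 1" k] k by (auto simp: basis_def elim!: evenE)
    next
      case False
      then have i: "1 \<le> m div 2 + 1" "m div 2 + 1 + 2 < n" using m by (auto elim!: oddE)
      then show ?thesis using m False gconj_twisted_comm[OF i k] e[OF i] Ncl
        by (auto simp: basis_def)
    qed
  qed
  have cN: "gconj k x \<in> ?N" if "x \<in> ?N" "k \<in> {1..<n}" for x k
    using that(1)
  proof induction
    case one
    then show ?case using that(2) gen_closed gen_square generate.one by (simp add: gconj_def)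
  next
    case (incl h) then show ?case using cB that(2) by simp
  next
    case (inv h)
    then have "gconj k (inv h) = inv (gconj k h)" using BD gconj_inv that(2) by auto
    then show ?case using cB[OF inv that(2)] Ncl by simp
  next
    case (eng h1 h2)
    then have "gconj k (h1 \<otimes> h2) = gconj k h1 \<otimes> gconj k h2" using ND gconj_mult[OF that(2)] by blast
    then show ?case using eng Ncl by simp
  qed
  have "?N \<lhd> G"
    by (rule normal_if_gen_conj_closed[OF N]) (use cN in \<open>simp add: gconj_def\<close>)
  moreover have "s i \<otimes> s j \<otimes> s i \<otimes> s j \<in> ?N" if "i \<in> {1..<n}" "j \<in> {1..<n}" for i j
  proof -
    have c: "s i \<in> carrier G" "s j \<in> carrier G" using that gen_closed by auto
    consider "i = j" | "\<bar>int i - int j\<bar> \<ge> 2" | "j = i + 1" | "i = j + 1" by linarith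
    then show ?thesis
    proof cases
      case 1 then show ?thesis using c that gen_square generate.one by (simp add: m_assoc)
    next
      case 2
      then have "s i \<otimes> s j \<otimes> s i \<otimes> s j = s j \<otimes> s i \<otimes> s i \<otimes> s j" using gens_commute that by simp
      then show ?thesis using c that gen_square generate.one by (simp add: m_assoc cancel_gen)
    next
      case 3 then show ?thesis using x[of i] that by (simp add: gen_comm_def)
    next
      case 4
      then have "s i \<otimes> s j \<otimes> s i \<otimes> s j = inv (gen_comm j)"
        using c that by (simp add: gen_comm_def inv_mult_group inv_gen m_assoc)
      then show ?thesis using x[of j] 4 that Ncl by simp
    qed
  qed
  ultimately show "D \<subseteq> ?N" by (rule derived_subset_if_gens_commute)
qed

abbreviation basis_product :: "(nat \<Rightarrow> int) \<Rightarrow> 'a" where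
  "basis_product f \<equiv> finprod A (\<lambda>m. basis m [^]\<^bsub>A\<^esub> f m) {..<2 * n - 5}"

lemma comm_group_A: "comm_group A"
  by (rule group.group_comm_groupI[OF subgroup_imp_group[OF D_subgroup]])
    (simp add: derived_commute)

sublocale A: comm_group A
  rewrites "carrier A = D" and "monoid.mult A = monoid.mult G" and "one A = one G"
  by (rule comm_group_A) simp_all

lemma inv_A: "x \<in> D \<Longrightarrow> inv\<^bsub>A\<^esub> x = inv x"
  by (rule m_inv_consistent[OF D_subgroup])

lemma basis_pow_closed: "(\<lambda>m. basis m [^]\<^bsub>A\<^esub> (f m :: int)) \<in> {..<2 * n - 5} \<rightarrow> D"
  using basis_in_D A.int_pow_closed by auto

lemma basis_product_mult:
  "basis_product f \<otimes> basis_product g = basis_product (\<lambda>m. f m + g m)"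
proof -
  have "basis_product f \<otimes> basis_product g =
      finprod A (\<lambda>m. basis m [^]\<^bsub>A\<^esub> f m \<otimes> basis m [^]\<^bsub>A\<^esub> g m) {..<2 * n - 5}"
    by (rule A.finprod_multf[symmetric]) (rule basis_pow_closed)+
  also have "\<dots> = basis_product (\<lambda>m. f m + g m)"
    by (rule A.finprod_cong') (use basis_in_D A.int_pow_mult basis_pow_closed in auto)
  finally show ?thesis .
qed

lemma basis_product_single:
  assumes "m < 2 * n - 5"
  shows "basis_product (\<lambda>j. if j = m then c else 0) = basis m [^]\<^bsub>A\<^esub> c"
proof -
  have "basis_product (\<lambda>j. if j = m then c else 0) =
      finprod A (\<lambda>j. if j = m then basis j [^]\<^bsub>A\<^esub> c else \<one>) {..<2 * n - 5}"
    by (rule A.finprod_cong') (use basis_in_D A.int_pow_closed in auto)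
  also have "\<dots> = basis m [^]\<^bsub>A\<^esub> c"
    by (rule A.finprod_singleton_swap) (use assms basis_in_D A.int_pow_closed in auto)
  finally show ?thesis .
qed

lemma D_basis_product:
  assumes "x \<in> D"
  obtains f where "x = basis_product f"
proof -
  have "x \<in> generate G (basis ` {..<2 * n - 5})" using assms D_eq_generate_basis by simp
  then have "\<exists>f. x = basis_product f"
  proof induction
    case one
    have "\<one> = basis_product (\<lambda>_. 0)" by (rule A.finprod_one_eqI[symmetric]) simp
    then show ?case by (intro exI[of _ "\<lambda>_. 0"])
  next
    case (incl h)
    then obtain m where m: "m < 2 * n - 5" "h = basis m" by auto
    have "h = basis_product (\<lambda>j. if j = m then 1 else 0)"
      unfolding basis_product_single[OF m(1)] m(2) using basis_in_D[OF m(1)] by (simp add: A.int_pow_1)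
    then show ?case by (intro exI[of _ "\<lambda>j. if j = m then 1 else 0"])
  next
    case (inv h)
    then obtain m where m: "m < 2 * n - 5" "h = basis m" by auto
    have "inv h = basis_product (\<lambda>j. if j = m then - 1 else 0)"
      unfolding basis_product_single[OF m(1)] m(2) using basis_in_D[OF m(1)]
      by (simp add: A.int_pow_neg A.int_pow_1 inv_A)
    then show ?case by (intro exI[of _ "\<lambda>j. if j = m then - 1 else 0"])
  next
    case (eng h1 h2)
    then obtain f g where "h1 = basis_product f" "h2 = basis_product g" by blast
    then have "h1 \<otimes> h2 = basis_product (\<lambda>m. f m + g m)" by (simp only: basis_product_mult)
    then show ?case by (intro exI[of _ "\<lambda>m. f m + g m"])
  qed
  then show thesis using that by blast
qed

end

section \<open>Coordinates in the infinite dihedral group\<close>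

text \<open>The pair \<open>(t, r)\<close> with \<open>r = 1\<close> or \<open>r = - 1\<close> stands for the isometry \<open>x \<mapsto> r x + t\<close> of the
  integers.\<close>

definition dihedral :: "(int \<times> int) monoid" where
  "dihedral =
    \<lparr>carrier = UNIV \<times> {1, - 1},
     monoid.mult = (\<lambda>(t, r) (u, r'). (t + r * u, r * r')),
     one = (0, 1)\<rparr>"

lemma dihedral_simps [simp]:
  "carrier dihedral = UNIV \<times> {1, - 1}"
  "(t, r) \<otimes>\<^bsub>dihedral\<^esub> (u, r') = (t + r * u, r * r')"
  "\<one>\<^bsub>dihedral\<^esub> = (0, 1)"
  by (simp_all add: dihedral_def)

lemma group_dihedral: "group dihedral"
proof (rule groupI)
  fix x assume "x \<in> carrier dihedral"
  then obtain t r where "x = (t, r)" "r = 1 \<or> r = - 1" by auto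
  then show "\<exists>y\<in>carrier dihedral. y \<otimes>\<^bsub>dihedral\<^esub> x = \<one>\<^bsub>dihedral\<^esub>"
    by (intro bexI[of _ "(- r * t, r)"]) auto
qed (auto simp: algebra_simps)

lemma inv_dihedral:
  assumes "r = 1 \<or> r = - 1"
  shows "inv\<^bsub>dihedral\<^esub> (t, r) = (- r * t, r)"
  by (rule group.inv_equality[OF group_dihedral]) (use assms in auto)

text \<open>The coordinates correspond to the sets \<open>{i, i + 1}\<close> and \<open>{i, i + 1, i + 2}\<close> of indices. In the
  coordinate \<open>m = 2q\<close> the generators \<open>s\<^sub>q\<^sub>+\<^sub>1\<close> and \<open>s\<^sub>q\<^sub>+\<^sub>2\<close> act as the two standard
  reflections. In the coordinate \<open>m = 2q + 1\<close> the commuting generators \<open>s\<^sub>q\<^sub>+\<^sub>1\<close> and \<open>s\<^sub>q\<^sub>+\<^sub>3\<close> act as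
  the first reflection and \<open>s\<^sub>q\<^sub>+\<^sub>2\<close> as the second one.\<close>

definition coord_gen :: "nat \<Rightarrow> nat \<Rightarrow> int \<times> int" where
  "coord_gen m k =
    (if k = m div 2 + 1 \<or> odd m \<and> k = m div 2 + 3 then (0, - 1)
     else if k = m div 2 + 2 then (1, - 1)
     else (0, 1))"

lemma coord_gen_closed: "coord_gen m k \<in> carrier dihedral"
  by (simp add: coord_gen_def)

lemma coord_gen_square: "coord_gen m k \<otimes>\<^bsub>dihedral\<^esub> coord_gen m k = \<one>\<^bsub>dihedral\<^esub>"
  by (simp add: coord_gen_def)

lemma coord_gen_commute:
  assumes "\<bar>int i - int j\<bar> \<ge> 2"
  shows "coord_gen m i \<otimes>\<^bsub>dihedral\<^esub> coord_gen m j = coord_gen m j \<otimes>\<^bsub>dihedral\<^esub> coord_gen m i"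
  using assms by (auto simp: coord_gen_def)

locale twin_coordinates = involution_generated_group G "{1..<n}" s
  for G (structure) and n :: nat and s :: "nat \<Rightarrow> 'a" +
  fixes \<phi> :: "nat \<Rightarrow> 'a \<Rightarrow> int \<times> int"
  assumes coord_hom: "\<phi> m \<in> hom G dihedral"
    and coord_gen: "k \<in> {1..<n} \<Longrightarrow> \<phi> m (s k) = coord_gen m k"
begin

lemma coord_mult:
  "x \<in> carrier G \<Longrightarrow> y \<in> carrier G \<Longrightarrow> \<phi> m (x \<otimes> y) = \<phi> m x \<otimes>\<^bsub>dihedral\<^esub> \<phi> m y"
  by (rule hom_mult[OF coord_hom])

lemma coord_one: "\<phi> m \<one> = (0, 1)"
  using hom_one[OF coord_hom is_group group_dihedral] by simp

lemma coord_closed: "x \<in> carrier G \<Longrightarrow> \<phi> m x \<in> carrier dihedral"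
  by (rule hom_in_carrier[OF coord_hom])

lemma coord_cases:
  assumes "x \<in> carrier G"
  obtains t r where "\<phi> m x = (t, r)" "r = 1 \<or> r = - 1"
  using coord_closed[OF assms, of m] by auto

lemma coord_inv: "x \<in> carrier G \<Longrightarrow> \<phi> m (inv x) = inv\<^bsub>dihedral\<^esub> \<phi> m x"
  using group_hom.hom_inv[of G dihedral "\<phi> m"] coord_hom group_dihedral
  by (simp add: group_hom_def group_hom_axioms_def)

text \<open>The sign of a dihedral element is a homomorphism to an abelian group, hence trivial on
  commutators.\<close>

lemma coord_derived:
  assumes "x \<in> derived G (carrier G)"
  shows "snd (\<phi> m x) = 1"
  using assms unfolding derived_def
proof induction
  case one
  show ?case by (simp add: coord_one)
next
  have comm: "snd (\<phi> m h) = 1 \<and> h \<in> carrier G" if h: "h \<in> derived_set G (carrier G)" for h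
  proof -
    obtain x y where xy: "x \<in> carrier G" "y \<in> carrier G" "h = x \<otimes> y \<otimes> inv x \<otimes> inv y"
      using h by blast
    obtain t r where x: "\<phi> m x = (t, r)" "r = 1 \<or> r = - 1" using xy(1) by (rule coord_cases)
    obtain u r' where y: "\<phi> m y = (u, r')" "r' = 1 \<or> r' = - 1" using xy(2) by (rule coord_cases)
    have "snd (\<phi> m h) = r * r' * r * r'"
      using xy by (simp add: coord_mult coord_inv x y inv_dihedral)
    then show ?thesis using x(2) y(2) xy by auto
  qed
  {
    case (incl h)
    then show ?case using comm by blast
  next
    case (inv h)
    then have "snd (\<phi> m h) = 1" "h \<in> carrier G" using comm by blast+
    then obtain t where "\<phi> m h = (t, 1)" by (metis prod.collapse)
    then show ?case using \<open>h \<in> carrier G\<close> by (simp add: coord_inv inv_dihedral)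
  next
    case (eng h1 h2)
    then have "h1 \<in> carrier G" "h2 \<in> carrier G"
      using derived_in_carrier[of "carrier G"] unfolding derived_def by blast+
    then show ?case using eng.IH by (cases "\<phi> m h1"; cases "\<phi> m h2") (simp add: coord_mult)
  }
qed

text \<open>The translation part in an even coordinate and the sign in coordinate 0 recover the
  exponents modulo 2 of the generators.\<close>

lemma coord_kernel_derived:
  assumes n: "n \<ge> 3"
    and ab: "ab \<in> hom G (product_group {1..<n} (\<lambda>_. integer_mod_group 2))"
    and gens: "\<And>k. k \<in> {1..<n} \<Longrightarrow> ab (s k) = (\<lambda>j\<in>{1..<n}. if j = k then 1 else 0)"
    and x: "x \<in> carrier G" and ker: "\<And>m. m < 2 * n - 5 \<Longrightarrow> \<phi> m x = (0, 1)"
  shows "x \<in> derived G (carrier G)"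
proof -
  let ?P = "product_group {1..<n} (\<lambda>_. integer_mod_group 2)"
  have ab_mult: "ab (s k \<otimes> y) i = ((if i = k then 1 else 0) + ab y i) mod 2"
    if "k \<in> {1..<n}" "y \<in> carrier G" "i \<in> {1..<n}" for k y i
    using that(3) hom_mult[OF ab gen_closed[OF that(1)] that(2)] by (simp add: gens[OF that(1)])
  have ab_one: "ab \<one> i = 0" if "i \<in> {1..<n}" for i
    using hom_one[OF ab is_group] that by simp
  have bit: "ab y i = 0 \<or> ab y i = 1" if "y \<in> carrier G" "i \<in> {1..<n}" for y i
  proof -
    have "ab y \<in> carrier ?P" using hom_in_carrier[OF ab that(1)] .
    then have "ab y i \<in> {0..<2}" using that(2) by (auto simp: carrier_integer_mod_group PiE_iff)
    then show ?thesis by auto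
  qed
  have step: "\<phi> m (s k \<otimes> y) = coord_gen m k \<otimes>\<^bsub>dihedral\<^esub> \<phi> m y"
    if "k \<in> {1..<n}" "y \<in> carrier G" for m k y
    using coord_mult[OF gen_closed[OF that(1)] that(2)] coord_gen[OF that(1)] by simp
  \<comment> \<open>In coordinate \<open>2q\<close> the only generator with an odd translation part is \<open>s\<^sub>q\<^sub>+\<^sub>2\<close>.\<close>
  have high: "even (fst (\<phi> (2 * q) y)) \<longleftrightarrow> ab y i = 0"
    if "i = q + 2" and i: "i \<in> {1..<n}" and "y \<in> carrier G" for q i y
    using that(3)
  proof (induction rule: gen_induct)
    case one
    show ?case using ab_one[OF i] by (simp add: coord_one)
  next
    case (mult k y)
    obtain t r where tr: "\<phi> (2 * q) y = (t, r)" by force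
    have "coord_gen (2 * q) k = (0, - 1) \<and> k \<noteq> i \<or> coord_gen (2 * q) k = (1, - 1) \<and> k = i \<or>
        coord_gen (2 * q) k = (0, 1) \<and> k \<noteq> i"
      using that(1) by (auto simp: coord_gen_def)
    then show ?case
      unfolding step[OF mult(1,2)] ab_mult[OF mult(1,2) i] tr
      using bit[OF mult(2) i] mult.IH tr by auto
  qed
  have I: "1 \<in> {1..<n}" "2 \<in> {1..<n}" using n by auto
  \<comment> \<open>In coordinate 0 the generators with negative sign are \<open>s\<^sub>1\<close> and \<open>s\<^sub>2\<close>.\<close>
  have low: "snd (\<phi> 0 y) = 1 \<longleftrightarrow> ab y 1 = ab y 2" if "y \<in> carrier G" for y
    using that
  proof (induction rule: gen_induct)
    case one
    show ?case using ab_one[OF I(1)] ab_one[OF I(2)] by (simp add: coord_one)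
  next
    case (mult k y)
    obtain t r where tr: "\<phi> 0 y = (t, r)" "r = 1 \<or> r = - 1" using mult(2) by (rule coord_cases)
    have "coord_gen 0 k = (0, - 1) \<and> k = 1 \<or> coord_gen 0 k = (1, - 1) \<and> k = 2 \<or>
        coord_gen 0 k = (0, 1) \<and> k \<noteq> 1 \<and> k \<noteq> 2"
      by (auto simp: coord_gen_def)
    then show ?case
      unfolding step[OF mult(1,2)] ab_mult[OF mult(1,2) I(1)] ab_mult[OF mult(1,2) I(2)] tr(1)
      using bit[OF mult(2) I(1)] bit[OF mult(2) I(2)] mult.IH tr by auto
  qed
  have zero: "ab x i = 0" if i: "i \<in> {1..<n}" for i
  proof -
    have "ab x j = 0" if "2 \<le> j" "j < n" for j
      using high[of j "j - 2" x] ker[of "2 * (j - 2)"] x that by simp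
    then show ?thesis using low[OF x] ker[of 0] i n by (cases "i = 1") auto
  qed
  have "ab x = \<one>\<^bsub>?P\<^esub>"
    using hom_in_carrier[OF ab x] zero by (auto simp: PiE_iff extensional_def fun_eq_iff)
  then have "x \<in> kernel G ?P ab" using x by (simp add: kernel_def)
  then show ?thesis using kernel_Z2_product[OF _ ab gens] by simp
qed

text \<open>An element with a reflection part squares to the identity, and a translation of finite order
  is trivial.\<close>

lemma coord_square_if_torsion:
  assumes "x \<in> carrier G" "\<phi> m (x [^] k) = (0, 1)" "k > (0::nat)"
  shows "\<phi> m (x \<otimes> x) = (0, 1)"
proof -
  obtain t r where x: "\<phi> m x = (t, r)" "r = 1 \<or> r = - 1" using assms(1) by (rule coord_cases)
  show ?thesis
  proof (cases "r = 1")
    case True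
    have "\<phi> m (x [^] j) = (int j * t, 1)" for j :: nat
      by (induction j) (use assms(1) in \<open>auto simp: coord_one coord_mult x True algebra_simps\<close>)
    then have "int k * t = 0" using assms(2) by simp
    then show ?thesis using assms x True by (simp add: coord_mult)
  next
    case False
    then show ?thesis using assms(1) x by (simp add: coord_mult)
  qed
qed

end

text \<open>\<open>basis_translation m j\<close> is the translation by which the \<open>j\<close>-th basis element of the commutator
  subgroup acts in coordinate \<open>m\<close>.\<close>

definition basis_translation :: "nat \<Rightarrow> nat \<Rightarrow> int" where
  "basis_translation m j =
    (if even m then (if j = m then - 2 else 0)
     else (if j + 1 = m then - 2 else if j = m then - 4 else if j = m + 1 then 2 else 0))"

locale metabelian_twin_coordinates = metabelian_twin G n s + twin_coordinates G n s \<phi>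
  for G (structure) and n and s :: "nat \<Rightarrow> 'a" and \<phi>
begin

lemma coord_gen_comm:
  assumes "1 \<le> i" "i + 1 < n"
  shows "\<phi> m (gen_comm i) =
    (if i = m div 2 + 1 then - 2 else if odd m \<and> i = m div 2 + 2 then 2 else 0, 1)"
proof -
  have "\<phi> m (gen_comm i) = coord_gen m i \<otimes>\<^bsub>dihedral\<^esub> coord_gen m (i + 1)
      \<otimes>\<^bsub>dihedral\<^esub> coord_gen m i \<otimes>\<^bsub>dihedral\<^esub> coord_gen m (i + 1)"
    using assms gen_closed[of i] gen_closed[of "i + 1"]
    by (simp add: gen_comm_def coord_mult coord_gen)
  then show ?thesis by (simp add: coord_gen_def)
qed

lemma coord_twisted_comm:
  assumes "1 \<le> i" "i + 2 < n"
  shows "\<phi> m (twisted_comm i) = (if odd m \<and> i = m div 2 + 1 then - 4 else 0, 1)"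
proof -
  have x: "gen_comm i \<in> carrier G" "s (i + 2) \<in> carrier G"
    using assms gen_closed[of "i + 2"] D_carrier[OF gen_comm_in_D[of i]] by auto
  have "\<phi> m (twisted_comm i) = \<phi> m (gen_comm i) \<otimes>\<^bsub>dihedral\<^esub>
      inv\<^bsub>dihedral\<^esub> (coord_gen m (i + 2) \<otimes>\<^bsub>dihedral\<^esub> \<phi> m (gen_comm i) \<otimes>\<^bsub>dihedral\<^esub> coord_gen m (i + 2))"
    using x assms coord_gen[of "i + 2" m]
    by (simp add: twisted_comm_def gconj_def coord_mult coord_inv)
  then show ?thesis
    using assms by (simp add: coord_gen_comm coord_gen_def inv_dihedral)
qed

lemma coord_basis:
  assumes "j < 2 * n - 5"
  shows "\<phi> m (basis j) = (basis_translation m j, 1)"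
proof -
  obtain q where m: "m = 2 * q \<or> m = 2 * q + 1" by (metis evenE oddE)
  show ?thesis
  proof (cases "even j")
    case True
    then obtain r where j: "j = 2 * r" by blast
    have "1 \<le> r + 1" "r + 1 + 1 < n" using assms j by auto
    then have "\<phi> m (gen_comm (r + 1)) =
        (if r + 1 = m div 2 + 1 then - 2 else if odd m \<and> r + 1 = m div 2 + 2 then 2 else 0, 1)"
      by (rule coord_gen_comm)
    then show ?thesis using m
      by (elim disjE) (simp_all add: j basis_def basis_translation_def)
  next
    case False
    then obtain r where j: "j = 2 * r + 1" using oddE by blast
    have "1 \<le> r + 1" "r + 1 + 2 < n" using assms j by auto
    then have "\<phi> m (twisted_comm (r + 1)) = (if odd m \<and> r + 1 = m div 2 + 1 then - 4 else 0, 1)"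
      by (rule coord_twisted_comm)
    then show ?thesis using m
      by (elim disjE) (simp_all add: j basis_def basis_translation_def, presburger)
  qed
qed

lemma coord_D_mult:
  assumes "x \<in> D" "y \<in> D"
  shows "fst (\<phi> m (x \<otimes> y)) = fst (\<phi> m x) + fst (\<phi> m y)"
  using coord_derived[OF assms(1), of m] D_carrier[OF assms(1)] D_carrier[OF assms(2)]
  by (cases "\<phi> m x"; cases "\<phi> m y") (simp add: coord_mult)

lemma coord_hom_A: "(\<lambda>x. fst (\<phi> m x)) \<in> hom A integer_group"
  by (rule homI) (simp_all add: coord_D_mult)

lemma coord_basis_pow:
  assumes "j < 2 * n - 5"
  shows "fst (\<phi> m (basis j [^]\<^bsub>A\<^esub> (k :: int))) = k * basis_translation m j"
proof -
  interpret h: group_hom A integer_group "\<lambda>x. fst (\<phi> m x)"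
    by (rule group_hom.intro[OF A.is_group group_integer_group])
      (simp add: group_hom_axioms_def coord_hom_A)
  show ?thesis
    using h.hom_int_pow[of "basis j" k] basis_in_D[OF assms] coord_basis[OF assms]
    by simp
qed

lemma coord_basis_product:
  "\<phi> m (basis_product f) = (\<Sum>j<2 * n - 5. f j * basis_translation m j, 1)"
proof -
  have F: "(\<lambda>m. basis m [^]\<^bsub>A\<^esub> f m) \<in> {..<J} \<rightarrow> D" if "J \<le> 2 * n - 5" for J
    using basis_pow_closed[of f] that by (auto simp: Pi_iff)
  have "fst (\<phi> m (finprod A (\<lambda>m. basis m [^]\<^bsub>A\<^esub> f m) {..<J})) = (\<Sum>j<J. f j * basis_translation m j)"
    if "J \<le> 2 * n - 5" for J
    using that
  proof (induction J)
    case 0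
    show ?case by (simp add: coord_one)
  next
    case (Suc J)
    have J: "J < 2 * n - 5" "J \<le> 2 * n - 5" using Suc.prems by auto
    have "finprod A (\<lambda>m. basis m [^]\<^bsub>A\<^esub> f m) {..<Suc J} =
        basis J [^]\<^bsub>A\<^esub> f J \<otimes> finprod A (\<lambda>m. basis m [^]\<^bsub>A\<^esub> f m) {..<J}"
      unfolding lessThan_Suc
      by (rule A.finprod_insert) (use F[OF J(2)] F[OF Suc.prems] in auto)
    moreover have "basis J [^]\<^bsub>A\<^esub> f J \<in> D" using F[OF Suc.prems] by auto
    moreover have "finprod A (\<lambda>m. basis m [^]\<^bsub>A\<^esub> f m) {..<J} \<in> D"
      using A.finprod_closed F[OF J(2)] by simp
    ultimately show ?case
      using Suc.IH[OF J(2)] coord_basis_pow[OF J(1)] by (simp add: coord_D_mult add.commute)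
  qed
  then have "fst (\<phi> m (basis_product f)) = (\<Sum>j<2 * n - 5. f j * basis_translation m j)" by simp
  moreover have "snd (\<phi> m (basis_product f)) = 1"
    by (rule coord_derived) (use A.finprod_closed basis_pow_closed in simp)
  ultimately show ?thesis by (simp add: prod_eq_iff)
qed

text \<open>The index \<open>m + 1\<close> is in range for odd \<open>m\<close>, since the last coordinate \<open>2n - 6\<close> is even.\<close>

lemma sum_basis_translation:
  assumes "m < 2 * n - 5"
  shows "(\<Sum>j<2 * n - 5. f j * basis_translation m j) =
    (if even m then - 2 * f m else - 2 * f (m - 1) - 4 * f m + 2 * f (m + 1))"
proof (cases "even m")
  case True
  then have "(\<Sum>j<2 * n - 5. f j * basis_translation m j) =
      (\<Sum>j<2 * n - 5. if j = m then - 2 * f j else 0)"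
    by (intro sum.cong) (auto simp: basis_translation_def)
  then show ?thesis using True assms by simp
next
  case False
  then obtain q where m: "m = 2 * q + 1" using oddE by blast
  then have lt: "m - 1 < 2 * n - 5" "m + 1 < 2 * n - 5" using assms by presburger+
  have "(\<Sum>j<2 * n - 5. f j * basis_translation m j) = (\<Sum>j<2 * n - 5.
      (if j = m - 1 then - 2 * f j else 0) + (if j = m then - 4 * f j else 0) +
      (if j = m + 1 then 2 * f j else 0))"
    using m by (intro sum.cong) (auto simp: basis_translation_def)
  then show ?thesis using False assms lt by (simp add: sum.distrib)
qed

text \<open>The translations of the basis elements form a triangular system: the even coordinates
  determine the exponents with even index, and then each odd coordinate determines its own.\<close>

lemma coord_inj_on_D:
  assumes "x \<in> D" and ker: "\<And>m. m < 2 * n - 5 \<Longrightarrow> \<phi> m x = (0, 1)"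
  shows "x = \<one>"
proof -
  obtain f where f: "x = basis_product f" using assms(1) by (rule D_basis_product)
  have eq: "(if even m then - 2 * f m else - 2 * f (m - 1) - 4 * f m + 2 * f (m + 1)) = 0"
    if "m < 2 * n - 5" for m
    using ker[OF that] sum_basis_translation[OF that, of f] coord_basis_product[of m f] f by simp
  have ev: "f m = 0" if "m < 2 * n - 5" "even m" for m using eq[OF that(1)] that(2) by simp
  have "f m = 0" if m: "m < 2 * n - 5" for m
  proof (cases "even m")
    case False
    then obtain q where "m = 2 * q + 1" using oddE by blast
    then have "even (m - 1)" "even (m + 1)" "m - 1 < 2 * n - 5" "m + 1 < 2 * n - 5"
      using m by (simp, simp, presburger+)
    then have "f (m - 1) = 0" "f (m + 1) = 0" using ev by simp_all
    then show ?thesis using eq[OF m] False by simp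
  qed (use ev m in simp)
  then show ?thesis unfolding f by (intro A.finprod_one_eqI) simp
qed

lemma coord_contains_lattice:
  obtains x where "x \<in> D" "\<And>m. m < 2 * n - 5 \<Longrightarrow> \<phi> m x = (4 * w m, 1)"
proof
  \<comment> \<open>This is the solution of the triangular system, integral because its right-hand side is
    divisible by 4.\<close>
  define f where "f m = (if even m then - 2 * w m else w (m - 1) - w m - w (m + 1))" for m
  show "basis_product f \<in> D" using A.finprod_closed basis_pow_closed by simp
  show "\<phi> m (basis_product f) = (4 * w m, 1)" if "m < 2 * n - 5" for m
    unfolding coord_basis_product sum_basis_translation[OF that] by (simp add: f_def)
qed

end

section \<open>Signed integer translations of Euclidean space\<close>

lemma euclidean_isometry_simps [simp]:
  "(v, M) \<in> carrier (euclidean_isometry_group d) \<longleftrightarrow>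
    v \<in> carrier_vec d \<and> M \<in> carrier_mat d d \<and> transpose_mat M * M = 1\<^sub>m d"
  "(v, M) \<otimes>\<^bsub>euclidean_isometry_group d\<^esub> (w, N) = (v + M *\<^sub>v w, M * N)"
  "\<one>\<^bsub>euclidean_isometry_group d\<^esub> = (0\<^sub>v d, 1\<^sub>m d)"
  by (simp_all add: euclidean_isometry_group_def)

lemma group_euclidean_isometry: "group (euclidean_isometry_group d)"
proof (rule groupI)
  let ?E = "euclidean_isometry_group d"
  show "\<one>\<^bsub>?E\<^esub> \<in> carrier ?E" by simp
  fix x assume "x \<in> carrier ?E"
  then obtain v M where x: "x = (v, M)" and v: "v \<in> carrier_vec d" and M: "M \<in> carrier_mat d d"
    and orth: "transpose_mat M * M = 1\<^sub>m d" by (cases x) auto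
  show "\<one>\<^bsub>?E\<^esub> \<otimes>\<^bsub>?E\<^esub> x = x" using v M by (simp add: x)
  have MT: "transpose_mat M \<in> carrier_mat d d" using M by simp
  have "M * transpose_mat M = 1\<^sub>m d" by (rule mat_mult_left_right_inverse[OF MT M orth])
  then have "(- (transpose_mat M *\<^sub>v v), transpose_mat M) \<in> carrier ?E" using v M MT by simp
  moreover have "(- (transpose_mat M *\<^sub>v v), transpose_mat M) \<otimes>\<^bsub>?E\<^esub> x = \<one>\<^bsub>?E\<^esub>"
    using v M MT orth by (simp add: x uminus_l_inv_vec[of _ d])
  ultimately show "\<exists>y\<in>carrier ?E. y \<otimes>\<^bsub>?E\<^esub> x = \<one>\<^bsub>?E\<^esub>" by blast
  fix y assume "y \<in> carrier ?E"
  then obtain w N where y: "y = (w, N)" and w: "w \<in> carrier_vec d" and N: "N \<in> carrier_mat d d"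
    and orthN: "transpose_mat N * N = 1\<^sub>m d" by (cases y) auto
  have NT: "transpose_mat N \<in> carrier_mat d d" using N by simp
  have "transpose_mat (M * N) * (M * N) = transpose_mat N * (transpose_mat M * M * N)"
    using M N MT NT
    by (simp add: transpose_mult[OF M N] assoc_mult_mat[OF NT MT mult_carrier_mat[OF M N]]
        assoc_mult_mat[OF MT M N])
  also have "\<dots> = 1\<^sub>m d" using N orth orthN by simp
  finally show "x \<otimes>\<^bsub>?E\<^esub> y \<in> carrier ?E" using v w M N by (simp add: x y)
  fix z assume "z \<in> carrier ?E"
  then obtain u L where z: "z = (u, L)" and u: "u \<in> carrier_vec d" and L: "L \<in> carrier_mat d d"
    by (cases z) auto
  show "x \<otimes>\<^bsub>?E\<^esub> y \<otimes>\<^bsub>?E\<^esub> z = x \<otimes>\<^bsub>?E\<^esub> (y \<otimes>\<^bsub>?E\<^esub> z)"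
    using v w u M N L
    by (simp add: x y z assoc_mult_mat[OF M N L] assoc_mult_mat_vec[OF M N u]
        mult_add_distrib_mat_vec[OF M w mult_mat_vec_carrier[OF N u]] assoc_add_vec[of _ d])
qed

definition signed_translation :: "nat \<Rightarrow> (nat \<Rightarrow> int \<times> int) \<Rightarrow> real vec \<times> real mat" where
  "signed_translation d u =
    (vec d (\<lambda>i. of_int (fst (u i))),
     mat d d (\<lambda>(i, j). if i = j then of_int (snd (u i)) else 0))"

lemma signed_translation_closed:
  assumes "\<And>i. i < d \<Longrightarrow> u i \<in> carrier dihedral"
  shows "signed_translation d u \<in> carrier (euclidean_isometry_group d)"
proof -
  let ?M = "mat d d (\<lambda>(i, j). if i = j then of_int (snd (u i)) else 0) :: real mat"
  have "transpose_mat ?M * ?M = 1\<^sub>m d"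
  proof (rule eq_matI)
    fix i j assume "i < dim_row (1\<^sub>m d :: real mat)" "j < dim_col (1\<^sub>m d :: real mat)"
    then have ij: "i < d" "j < d" by auto
    have "(transpose_mat ?M * ?M) $$ (i, j) =
        (\<Sum>k = 0..<d. (if k = i then of_int (snd (u k)) else 0) * (if k = j then of_int (snd (u k)) else 0))"
      using ij by (simp add: scalar_prod_def)
    also have "\<dots> = (\<Sum>k = 0..<d. if k = i then (if i = j then of_int (snd (u i) * snd (u i)) else 0) else 0)"
      by (rule sum.cong) auto
    also have "\<dots> = (1\<^sub>m d :: real mat) $$ (i, j)"
      using ij assms[of i] by (auto simp: mem_Times_iff)
    finally show "(transpose_mat ?M * ?M) $$ (i, j) = (1\<^sub>m d :: real mat) $$ (i, j)" .
  qed simp_all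
  then show ?thesis by (simp add: signed_translation_def)
qed

lemma signed_translation_mult:
  "signed_translation d u \<otimes>\<^bsub>euclidean_isometry_group d\<^esub> signed_translation d v =
    signed_translation d (\<lambda>i. u i \<otimes>\<^bsub>dihedral\<^esub> v i)"
proof -
  have mult: "u i \<otimes>\<^bsub>dihedral\<^esub> v i = (fst (u i) + snd (u i) * fst (v i), snd (u i) * snd (v i))" for i
    by (cases "u i"; cases "v i") simp
  have delta: "(\<Sum>k = 0..<d. (if i = k then a else 0) * f k) = a * f i" if "i < d" for i a and f :: "nat \<Rightarrow> real"
  proof -
    have "(\<Sum>k = 0..<d. (if i = k then a else 0) * f k) = (\<Sum>k = 0..<d. if k = i then a * f k else 0)"
      by (rule sum.cong) auto
    then show ?thesis using that by simp
  qed
  show ?thesis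
    unfolding signed_translation_def mult euclidean_isometry_simps
    by (intro prod_eqI eq_vecI eq_matI) (auto simp: scalar_prod_def delta)
qed

lemma signed_translation_eq_iff:
  "signed_translation d u = signed_translation d v \<longleftrightarrow> (\<forall>i<d. u i = v i)"
proof
  assume eq: "signed_translation d u = signed_translation d v"
  show "\<forall>i<d. u i = v i"
  proof (intro allI impI)
    fix i assume i: "i < d"
    have "fst (signed_translation d u) $ i = fst (signed_translation d v) $ i"
      "snd (signed_translation d u) $$ (i, i) = snd (signed_translation d v) $$ (i, i)"
      using eq by simp_all
    then show "u i = v i" using i by (simp add: signed_translation_def prod_eq_iff)
  qed
next
  assume "\<forall>i<d. u i = v i"
  then show "signed_translation d u = signed_translation d v"
    by (auto simp: signed_translation_def intro!: eq_vecI eq_matI)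
qed

section \<open>Discrete and uniform subgroups\<close>

definition entries :: "nat \<Rightarrow> real vec \<times> real mat \<Rightarrow> (nat \<Rightarrow> real) \<times> (nat \<times> nat \<Rightarrow> real)" where
  "entries d = (\<lambda>(v, M). (\<lambda>i\<in>{..<d}. v $ i, \<lambda>p\<in>{..<d} \<times> {..<d}. M $$ p))"

definition entry_space :: "nat \<Rightarrow> ((nat \<Rightarrow> real) \<times> (nat \<times> nat \<Rightarrow> real)) topology" where
  "entry_space d =
    prod_topology (product_topology (\<lambda>_. euclideanreal) {..<d})
                  (product_topology (\<lambda>_. euclideanreal) ({..<d} \<times> {..<d}))"

lemma euclidean_isometry_topology_entries:
  "euclidean_isometry_topology d =
    pullback_topology (carrier (euclidean_isometry_group d)) (entries d) (entry_space d)"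
  by (simp add: euclidean_isometry_topology_def entries_def entry_space_def)

lemma entries_in_entry_space: "entries d x \<in> topspace (entry_space d)"
  by (cases x) (auto simp: entries_def entry_space_def)

lemma topspace_euclidean_isometry:
  "topspace (euclidean_isometry_topology d) = carrier (euclidean_isometry_group d)"
  using entries_in_entry_space
  by (auto simp: euclidean_isometry_topology_entries topspace_pullback_topology)

text \<open>Integral entries at distance less than 1 agree.\<close>

lemma discrete_subgroup_if_signed_translations:
  assumes H: "subgroup H (euclidean_isometry_group d)" and "H \<subseteq> range (signed_translation d)"
  shows "discrete_subgroup d H"
proof -
  let ?X = "euclidean_isometry_topology d"
  have HE: "H \<subseteq> carrier (euclidean_isometry_group d)" using H by (rule subgroup.subset)
  have "openin (subtopology ?X H) {h}" if h: "h \<in> H" for h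
  proof -
    obtain u where u: "h = signed_translation d u" using assms(2) h by blast
    define a where "a i = (of_int (fst (u i)) :: real)" for i
    define b where "b = (\<lambda>(i, j). if i = j then of_int (snd (u i)) else (0 :: real))"
    define U where "U = (\<Pi>\<^sub>E i\<in>{..<d}. {a i - 1<..<a i + 1}) \<times>
      (\<Pi>\<^sub>E p\<in>{..<d} \<times> {..<d}. {b p - 1<..<b p + 1})"
    have "openin (entry_space d) U"
      unfolding entry_space_def U_def openin_prod_Times_iff by (simp add: openin_PiE)
    then have "openin ?X (entries d -` U \<inter> carrier (euclidean_isometry_group d))"
      unfolding euclidean_isometry_topology_entries openin_pullback_topology by blast
    moreover have "entries d -` U \<inter> carrier (euclidean_isometry_group d) \<inter> H = {h}"
    proof
      have "entries d h = (\<lambda>i\<in>{..<d}. a i, \<lambda>p\<in>{..<d} \<times> {..<d}. b p)"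
        by (auto simp: u signed_translation_def entries_def a_def b_def fun_eq_iff)
      then have "entries d h \<in> U" by (auto simp: U_def)
      then show "{h} \<subseteq> entries d -` U \<inter> carrier (euclidean_isometry_group d) \<inter> H"
        using h HE by auto
      show "entries d -` U \<inter> carrier (euclidean_isometry_group d) \<inter> H \<subseteq> {h}"
      proof
        fix g assume g: "g \<in> entries d -` U \<inter> carrier (euclidean_isometry_group d) \<inter> H"
        then obtain u' where u': "g = signed_translation d u'" using assms(2) by blast
        have gU: "entries d g \<in> U" using g by simp
        have "u i = u' i" if i: "i < d" for i
        proof -
          have "fst (entries d g) i \<in> {a i - 1<..<a i + 1}"
            "snd (entries d g) (i, i) \<in> {b (i, i) - 1<..<b (i, i) + 1}"
            using gU i by (auto simp: U_def PiE_iff)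
          then have "\<bar>real_of_int (fst (u i)) - of_int (fst (u' i))\<bar> < 1"
            "\<bar>real_of_int (snd (u i)) - of_int (snd (u' i))\<bar> < 1"
            using i by (simp_all add: u' entries_def signed_translation_def a_def b_def abs_less_iff)
          then have "fst (u i) = fst (u' i)" "snd (u i) = snd (u' i)" by linarith+
          then show ?thesis by (simp add: prod_eq_iff)
        qed
        then have "g = h" by (simp add: u u' signed_translation_eq_iff)
        then show "g \<in> {h}" by simp
      qed
    qed
    ultimately show ?thesis unfolding openin_subtopology by metis
  qed
  then have "discrete_topology H = subtopology ?X H"
    unfolding discrete_topology_unique using HE by (auto simp: topspace_euclidean_isometry)
  then show ?thesis using H by (simp add: discrete_subgroup_def)
qed

text \<open>The witness is the quotient topology: the finest one on the image that makes \<open>q\<close>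
  continuous.\<close>

lemma quotient_map_exists: "\<exists>Q. quotient_map X Q q"
proof -
  let ?L = "\<lambda>U. U \<subseteq> q ` topspace X \<and> openin X {x \<in> topspace X. q x \<in> U}"
  have "istopology ?L"
    unfolding istopology_def
  proof (intro conjI allI impI)
    fix S T assume "?L S" "?L T"
    then have "openin X ({x \<in> topspace X. q x \<in> S} \<inter> {x \<in> topspace X. q x \<in> T})" by blast
    moreover have "{x \<in> topspace X. q x \<in> S} \<inter> {x \<in> topspace X. q x \<in> T} = {x \<in> topspace X. q x \<in> S \<inter> T}"
      by auto
    ultimately show "openin X {x \<in> topspace X. q x \<in> S \<inter> T}" by simp
    show "S \<inter> T \<subseteq> q ` topspace X" using \<open>?L S\<close> by blast
  next
    fix K assume K: "\<forall>U\<in>K. ?L U"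
    then have "openin X (\<Union>U\<in>K. {x \<in> topspace X. q x \<in> U})" by (intro openin_Union) auto
    moreover have "(\<Union>U\<in>K. {x \<in> topspace X. q x \<in> U}) = {x \<in> topspace X. q x \<in> \<Union> K}" by auto
    ultimately show "openin X {x \<in> topspace X. q x \<in> \<Union> K}" by simp
    show "\<Union> K \<subseteq> q ` topspace X" using K by blast
  qed
  then have op: "openin (topology ?L) = ?L" by (rule topology_inverse')
  have "{x \<in> topspace X. q x \<in> q ` topspace X} = topspace X" by auto
  then have "openin (topology ?L) (q ` topspace X)" unfolding op by simp
  then have "q ` topspace X \<subseteq> topspace (topology ?L)" by (rule openin_subset)
  moreover have "topspace (topology ?L) \<subseteq> q ` topspace X"
    using openin_topspace[of "topology ?L"] unfolding op by (rule conjunct1)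
  ultimately have top: "q ` topspace X = topspace (topology ?L)" by (rule subset_antisym)
  have "openin X {x \<in> topspace X. q x \<in> U} \<longleftrightarrow> openin (topology ?L) U"
    if "U \<subseteq> topspace (topology ?L)" for U
    using that unfolding top[symmetric] op by simp
  then have "quotient_map X (topology ?L) q" using top by (simp only: quotient_map_def) blast
  then show ?thesis by blast
qed

text \<open>Open sets of the pullback are preimages, so a cover of \<open>K\<close> induces one of \<open>f ` K\<close>.\<close>

lemma compactin_pullback_topology:
  assumes "K \<subseteq> A" and comp: "compactin T (f ` K)"
  shows "compactin (pullback_topology A f T) K"
  unfolding compactin_def
proof (intro conjI allI impI)
  show "K \<subseteq> topspace (pullback_topology A f T)"
    using assms compactin_subset_topspace[OF comp] by (auto simp: topspace_pullback_topology)
  fix C assume C: "(\<forall>U\<in>C. openin (pullback_topology A f T) U) \<and> K \<subseteq> \<Union> C"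
  then have "\<forall>U\<in>C. \<exists>V. openin T V \<and> U = f -` V \<inter> A" by (simp add: openin_pullback_topology)
  then obtain V where V: "\<And>U. U \<in> C \<Longrightarrow> openin T (V U)" "\<And>U. U \<in> C \<Longrightarrow> U = f -` V U \<inter> A"
    by metis
  have "\<forall>W\<in>V ` C. openin T W" using V(1) by blast
  moreover have "f ` K \<subseteq> \<Union> (V ` C)" using C V(2) by blast
  ultimately obtain F where F: "finite F" "F \<subseteq> V ` C" "f ` K \<subseteq> \<Union> F"
    using comp unfolding compactin_def by meson
  then obtain F' where F': "F' \<subseteq> C" "finite F'" "F = V ` F'" by (meson finite_subset_image)
  have "K \<subseteq> \<Union> F'" using F(3) F' V(2) \<open>K \<subseteq> A\<close> by blast
  then show "\<exists>F'. finite F' \<and> F' \<subseteq> C \<and> K \<subseteq> \<Union> F'" using F' by blast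
qed

lemma transpose_mult_self_index:
  assumes "M \<in> carrier_mat d d" "i < d" "j < d"
  shows "(transpose_mat M * M) $$ (i, j) = (\<Sum>k<d. M $$ (k, i) * M $$ (k, j))"
  using assms by (simp add: scalar_prod_def lessThan_atLeast0)

text \<open>Together with a bounded set of translation vectors, the orthogonal matrices are cut out of a
  compact box of entries by a closed condition.\<close>

lemma compactin_orthogonal_times_box:
  "compactin (euclidean_isometry_topology d)
    {x \<in> carrier (euclidean_isometry_group d). \<forall>i<d. fst x $ i \<in> {0..c}}"
    (is "compactin _ ?K")
  unfolding euclidean_isometry_topology_entries
proof (rule compactin_pullback_topology)
  show "?K \<subseteq> carrier (euclidean_isometry_group d)" by auto
  \<comment> \<open>A single continuous function whose zeros are the matrices with orthonormal columns.\<close>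
  define defect where "defect x = (\<Sum>i<d. \<Sum>j<d. ((\<Sum>k<d. snd x (k, i) * snd x (k, j)) - (if i = j then 1 else 0))\<^sup>2)"
    for x :: "(nat \<Rightarrow> real) \<times> (nat \<times> nat \<Rightarrow> real)"
  define box where "box = (\<Pi>\<^sub>E i\<in>{..<d}. {0..c}) \<times> (\<Pi>\<^sub>E p\<in>{..<d} \<times> {..<d}. {- 1..1 :: real})"
  have "compactin (entry_space d) box"
    unfolding box_def entry_space_def compactin_Times compactin_PiE by simp
  moreover have "continuous_map (entry_space d) euclideanreal (\<lambda>x. snd x (k, i))" if "k < d" "i < d" for k i
  proof -
    have "continuous_map (product_topology (\<lambda>_. euclideanreal) ({..<d} \<times> {..<d})) euclideanreal (\<lambda>y. y (k, i))"
      by (rule continuous_map_product_projection) (use that in simp)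
    from continuous_map_compose[OF continuous_map_snd this] show ?thesis
      by (simp add: entry_space_def o_def)
  qed
  then have "continuous_map (entry_space d) euclideanreal defect"
    unfolding defect_def
    by (intro continuous_map_sum continuous_map_real_pow continuous_map_diff continuous_map_real_mult
        continuous_map_canonical_const) auto
  then have "closedin (entry_space d) {x \<in> topspace (entry_space d). defect x \<in> {0}}"
    by (rule closedin_continuous_map_preimage) simp
  ultimately have "compactin (entry_space d) (box \<inter> {x \<in> topspace (entry_space d). defect x \<in> {0}})"
    by (rule compact_Int_closedin)
  moreover have "box \<inter> {x \<in> topspace (entry_space d). defect x \<in> {0}} = entries d ` ?K"
  proof
    have defect_iff: "defect x = 0 \<longleftrightarrow>
        (\<forall>i<d. \<forall>j<d. (\<Sum>k<d. snd x (k, i) * snd x (k, j)) = (if i = j then 1 else 0))" for x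
      unfolding defect_def by (auto simp: sum_nonneg_eq_0_iff sum_nonneg)
    show "entries d ` ?K \<subseteq> box \<inter> {x \<in> topspace (entry_space d). defect x \<in> {0}}"
    proof
      fix y assume "y \<in> entries d ` ?K"
      then obtain v M where y: "y = entries d (v, M)" and v: "\<And>i. i < d \<Longrightarrow> v $ i \<in> {0..c}"
        and M: "M \<in> carrier_mat d d" "transpose_mat M * M = 1\<^sub>m d" by auto
      have orth: "(\<Sum>k<d. M $$ (k, i) * M $$ (k, j)) = (if i = j then 1 else 0)" if "i < d" "j < d" for i j
        using transpose_mult_self_index[OF M(1) that] M(2) that by simp
      have "M $$ (k, i) \<in> {- 1..1}" if "k < d" "i < d" for k i
      proof -
        have "(M $$ (k, i))\<^sup>2 \<le> (\<Sum>k<d. (M $$ (k, i))\<^sup>2)"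
          by (rule member_le_sum) (use that in auto)
        also have "\<dots> = 1" using orth[OF that(2) that(2)] by (simp add: power2_eq_square)
        finally have "\<bar>M $$ (k, i)\<bar> \<le> 1" by (simp add: abs_square_le_1)
        then show ?thesis by auto
      qed
      then have "y \<in> box" using v by (auto simp: y entries_def box_def)
      moreover have "defect y = 0" unfolding defect_iff using orth by (simp add: y entries_def)
      ultimately show "y \<in> box \<inter> {x \<in> topspace (entry_space d). defect x \<in> {0}}"
        using entries_in_entry_space y by simp
    qed
    show "box \<inter> {x \<in> topspace (entry_space d). defect x \<in> {0}} \<subseteq> entries d ` ?K"
    proof
      fix y assume y: "y \<in> box \<inter> {x \<in> topspace (entry_space d). defect x \<in> {0}}"
      obtain a b where ab: "y = (a, b)" by force
      have orth: "(\<Sum>k<d. b (k, i) * b (k, j)) = (if i = j then 1 else 0)" if "i < d" "j < d" for i j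
        using y that by (auto simp: defect_iff ab)
      let ?M = "mat d d b"
      have "transpose_mat ?M * ?M = 1\<^sub>m d"
      proof (rule eq_matI)
        fix i j assume "i < dim_row (1\<^sub>m d :: real mat)" "j < dim_col (1\<^sub>m d :: real mat)"
        then have ij: "i < d" "j < d" by auto
        then show "(transpose_mat ?M * ?M) $$ (i, j) = 1\<^sub>m d $$ (i, j)"
          using orth[OF ij] by (simp add: transpose_mult_self_index[OF mat_carrier ij])
      qed auto
      then have "(vec d a, ?M) \<in> ?K" using y by (auto simp: ab box_def PiE_iff)
      moreover have "entries d (vec d a, ?M) = y"
        using y by (auto simp: ab box_def entries_def fun_eq_iff PiE_iff extensional_def)
      ultimately show "y \<in> entries d ` ?K" by force
    qed
  qed
  ultimately show "compactin (entry_space d) (entries d ` ?K)" by simp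
qed

text \<open>Every isometry can be moved by a lattice translation into the compact set of the previous
  lemma.\<close>

lemma uniform_subgroup_if_lattice:
  assumes H: "subgroup H (euclidean_isometry_group d)" and "c > 0"
    and lattice: "\<And>w. signed_translation d (\<lambda>i. (c * w i, 1)) \<in> H"
  shows "uniform_subgroup d H"
proof -
  let ?E = "euclidean_isometry_group d" and ?X = "euclidean_isometry_topology d"
  interpret E: group ?E by (rule group_euclidean_isometry)
  let ?q = "\<lambda>g. H #>\<^bsub>?E\<^esub> g"
  let ?K = "{x \<in> carrier ?E. \<forall>i<d. fst x $ i \<in> {0..real_of_int c}}"
  obtain Q where Q: "quotient_map ?X Q ?q" using quotient_map_exists by blast
  have "?q ` carrier ?E \<subseteq> ?q ` ?K"
  proof
    fix y assume "y \<in> ?q ` carrier ?E"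
    then obtain v M where y: "y = ?q (v, M)" and v: "v \<in> carrier_vec d" and M: "M \<in> carrier_mat d d"
      and orth: "transpose_mat M * M = 1\<^sub>m d" by auto
    define w where "w i = \<lfloor>v $ i / of_int c\<rfloor>" for i
    define h where "h = signed_translation d (\<lambda>i. (c * w i, 1))"
    define v' where "v' = vec d (\<lambda>i. v $ i - of_int (c * w i))"
    have h: "h \<in> H" unfolding h_def by (rule lattice)
    have hE: "h \<in> carrier ?E" using h H subgroup.mem_carrier by metis
    have g: "(v', M) \<in> carrier ?E" using M orth by (simp add: v'_def)
    have one: "mat d d (\<lambda>(i, j). if i = j then real_of_int 1 else 0) = 1\<^sub>m d"
      by (rule eq_matI) auto
    have "h \<otimes>\<^bsub>?E\<^esub> (v', M) = (v, M)"
    proof -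
      have "vec d (\<lambda>i. real_of_int (c * w i)) + v' = v" using v by (auto simp: v'_def)
      moreover have "1\<^sub>m d *\<^sub>v v' = v'" by (simp add: v'_def)
      ultimately show ?thesis
        unfolding h_def signed_translation_def fst_conv snd_conv one using M by simp
    qed
    then have "y = (H #>\<^bsub>?E\<^esub> h) #>\<^bsub>?E\<^esub> (v', M)"
      using E.coset_mult_assoc[OF subgroup.subset[OF H] hE g] y by simp
    then have "y = ?q (v', M)" using E.coset_join2[OF hE H h] by simp
    moreover have "0 \<le> v' $ i \<and> v' $ i \<le> of_int c" if "i < d" for i
    proof -
      have "of_int (w i) \<le> v $ i / of_int c" "v $ i / of_int c \<le> of_int (w i) + 1"
        unfolding w_def by linarith+
      then have "of_int (w i) * of_int c \<le> v $ i" "v $ i \<le> (of_int (w i) + 1) * of_int c"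
        using \<open>c > 0\<close> by (simp_all add: pos_le_divide_eq pos_divide_le_eq)
      then show ?thesis using that by (simp add: v'_def algebra_simps)
    qed
    ultimately show "y \<in> ?q ` ?K" using g by force
  qed
  then have "?q ` ?K = topspace Q"
    using Q by (auto simp: quotient_map_def topspace_euclidean_isometry)
  moreover have "compactin Q (?q ` ?K)"
    by (rule image_compactin[OF compactin_orthogonal_times_box quotient_imp_continuous_map[OF Q]])
  ultimately have "compact_space Q" by (simp add: compact_space_def)
  then show ?thesis using H Q by (auto simp: uniform_subgroup_def)
qed

section \<open>The quotient by the second commutator subgroup\<close>

lemma (in involution_generated_group) involution_generated_quotient:
  assumes "N \<lhd> G"
  shows "involution_generated_group (G Mod N) I (\<lambda>k. N #> s k)"
proof -
  interpret N: normal N G by fact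
  interpret Q: group "G Mod N" by (rule N.factorgroup_is_group)
  have Mod_mult: "(N #> x) \<otimes>\<^bsub>G Mod N\<^esub> (N #> y) = N #> (x \<otimes> y)"
    if "x \<in> carrier G" "y \<in> carrier G" for x y
    using that by (simp add: N.rcos_sum)
  have Mod_one: "\<one>\<^bsub>G Mod N\<^esub> = N #> \<one>" using N.subset by simp
  show ?thesis
  proof
    fix k assume k: "k \<in> I"
    show "N #> s k \<in> carrier (G Mod N)" using gen_closed[OF k] by (auto simp: carrier_FactGroup)
    show "(N #> s k) \<otimes>\<^bsub>G Mod N\<^esub> (N #> s k) = \<one>\<^bsub>G Mod N\<^esub>"
      unfolding Mod_mult[OF gen_closed[OF k] gen_closed[OF k]] gen_square[OF k] Mod_one by (rule HOL.refl)
  next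
    fix X P
    assume X: "X \<in> carrier (G Mod N)" and 1: "P \<one>\<^bsub>G Mod N\<^esub>"
      and step: "\<And>k Y. k \<in> I \<Longrightarrow> Y \<in> carrier (G Mod N) \<Longrightarrow> P Y \<Longrightarrow>
        P ((N #> s k) \<otimes>\<^bsub>G Mod N\<^esub> Y)"
    obtain x where x: "x \<in> carrier G" "X = N #> x" using X by (auto simp: carrier_FactGroup)
    from x(1) have "P (N #> x)"
    proof (induction rule: gen_induct)
      case one
      show ?case using 1 unfolding Mod_one .
    next
      case (mult k y)
      then have "P ((N #> s k) \<otimes>\<^bsub>G Mod N\<^esub> (N #> y))"
        by (intro step) (auto simp: carrier_FactGroup)
      then show ?case unfolding Mod_mult[OF gen_closed[OF mult(1)] mult(2)] .
    qed
    then show "P X" using x(2) by simp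
  qed
qed

lemma (in group) derived_Mod:
  assumes "N \<lhd> G"
  shows "derived (G Mod N) (carrier (G Mod N)) = (\<lambda>x. N #> x) ` derived G (carrier G)"
proof -
  interpret N: normal N G by fact
  interpret q: group_hom G "G Mod N" "\<lambda>x. N #> x"
    by (rule group_hom.intro[OF is_group N.factorgroup_is_group])
      (simp add: group_hom_axioms_def N.r_coset_hom_Mod)
  show ?thesis using q.derived_img[OF subset_refl] by (simp add: carrier_FactGroup)
qed

lemma (in group) second_derived_normal: "derived G (derived G (carrier G)) \<lhd> G"
  by (rule derived_is_normal[OF derived_self_is_normal])

lemma (in group) derived_Mod_second_derived_commute:
  defines "N \<equiv> derived G (derived G (carrier G))"
  assumes "X \<in> derived (G Mod N) (carrier (G Mod N))" "Y \<in> derived (G Mod N) (carrier (G Mod N))"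
  shows "X \<otimes>\<^bsub>G Mod N\<^esub> Y = Y \<otimes>\<^bsub>G Mod N\<^esub> X"
proof -
  have "N \<lhd> G" unfolding N_def by (rule second_derived_normal)
  interpret N: normal N G by fact
  obtain x y where x: "x \<in> derived G (carrier G)" "X = N #> x"
    and y: "y \<in> derived G (carrier G)" "Y = N #> y"
    using assms(2,3) unfolding derived_Mod[OF \<open>N \<lhd> G\<close>] by blast
  have c: "x \<in> carrier G" "y \<in> carrier G" using x(1) y(1) derived_in_carrier[OF subset_refl] by auto
  have "x \<otimes> y \<otimes> inv x \<otimes> inv y \<in> derived_set G (derived G (carrier G))" using x(1) y(1) by blast
  then have "x \<otimes> y \<otimes> inv x \<otimes> inv y \<in> N" unfolding N_def derived_def[of G "derived G _"] by (rule generate.incl)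
  then have "N #> (x \<otimes> y \<otimes> inv x \<otimes> inv y) = N" by (rule N.rcos_const[OF is_group])
  then have "(N #> (x \<otimes> y \<otimes> inv x \<otimes> inv y)) #> (y \<otimes> x) = N #> (y \<otimes> x)" by simp
  moreover have "(x \<otimes> y \<otimes> inv x \<otimes> inv y) \<otimes> (y \<otimes> x) = x \<otimes> y"
  proof -
    have "(x \<otimes> y \<otimes> inv x \<otimes> inv y) \<otimes> (y \<otimes> x) = x \<otimes> y \<otimes> inv x \<otimes> (inv y \<otimes> y) \<otimes> x"
      using c by (simp only: m_assoc m_closed inv_closed)
    also have "\<dots> = x \<otimes> y" using c by (simp add: m_assoc)
    finally show ?thesis .
  qed
  ultimately have "N #> (x \<otimes> y) = N #> (y \<otimes> x)"
    using coset_mult_assoc[OF N.subset, of "x \<otimes> y \<otimes> inv x \<otimes> inv y" "y \<otimes> x"] c by simp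
  then show ?thesis unfolding x(2) y(2) using c by (simp add: N.rcos_sum)
qed

text \<open>Translations commute, so the second commutator subgroup acts trivially in each coordinate.\<close>

lemma (in twin_coordinates) coord_second_derived:
  assumes "x \<in> derived G (derived G (carrier G))"
  shows "\<phi> m x = (0, 1)"
proof -
  interpret h: group_hom G dihedral "\<phi> m"
    by (rule group_hom.intro[OF is_group group_dihedral]) (simp add: group_hom_axioms_def coord_hom)
  have sub: "derived G (carrier G) \<subseteq> carrier G" by (rule derived_in_carrier[OF subset_refl])
  have "derived_set dihedral (\<phi> m ` derived G (carrier G)) \<subseteq> {\<one>\<^bsub>dihedral\<^esub>}"
  proof
    fix z assume "z \<in> derived_set dihedral (\<phi> m ` derived G (carrier G))"
    then obtain x y where xy: "x \<in> derived G (carrier G)" "y \<in> derived G (carrier G)"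
      and z: "z = \<phi> m x \<otimes>\<^bsub>dihedral\<^esub> \<phi> m y \<otimes>\<^bsub>dihedral\<^esub> inv\<^bsub>dihedral\<^esub> \<phi> m x \<otimes>\<^bsub>dihedral\<^esub> inv\<^bsub>dihedral\<^esub> \<phi> m y"
      by blast
    obtain t u where "\<phi> m x = (t, 1)" "\<phi> m y = (u, 1)"
      using coord_derived[OF xy(1), of m] coord_derived[OF xy(2), of m] by (metis prod.collapse)
    then show "z \<in> {\<one>\<^bsub>dihedral\<^esub>}" by (simp add: z inv_dihedral)
  qed
  then have "derived dihedral (\<phi> m ` derived G (carrier G)) \<subseteq> {\<one>\<^bsub>dihedral\<^esub>}"
    unfolding derived_def[of dihedral] by (rule h.H.generate_subgroup_incl[OF _ h.H.triv_subgroup])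
  then show ?thesis using h.derived_img[OF sub] assms by auto
qed

lemma (in twin_coordinates) coordinates_descend:
  defines "N \<equiv> derived G (derived G (carrier G))"
  obtains \<psi> where "twin_coordinates (G Mod N) n (\<lambda>k. N #> s k) \<psi>"
    "\<And>m x. x \<in> carrier G \<Longrightarrow> \<psi> m (N #> x) = \<phi> m x"
proof -
  have "N \<lhd> G" unfolding N_def by (rule second_derived_normal)
  interpret N: normal N G by fact
  have "\<phi> m x = \<phi> m y" if xy: "x \<in> carrier G" "y \<in> carrier G" "N #> x = N #> y" for m x y
  proof -
    have "x \<in> N #> y" using rcos_self[OF xy(1) N.subgroup_axioms] xy(3) by simp
    then obtain z where z: "z \<in> N" "x = z \<otimes> y" by (auto simp: r_coset_def)
    have "\<phi> m z = \<one>\<^bsub>dihedral\<^esub>" using coord_second_derived z(1) unfolding N_def by simp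
    then show ?thesis
      using z xy(2) N.mem_carrier[OF z(1)] coord_closed[OF xy(2), of m]
        group.is_monoid[OF group_dihedral] by (simp add: coord_mult monoid.l_one del: dihedral_simps)
  qed
  then have "\<exists>g. g \<in> hom (G Mod N) dihedral \<and> (\<forall>x\<in>carrier G. g (N #> x) = \<phi> m x)" for m
    by (rule FactGroup_universal[OF coord_hom \<open>N \<lhd> G\<close>, of m]) auto
  then obtain \<psi> where \<psi>: "\<And>m. \<psi> m \<in> hom (G Mod N) dihedral"
    "\<And>m x. x \<in> carrier G \<Longrightarrow> \<psi> m (N #> x) = \<phi> m x" by metis
  have "twin_coordinates (G Mod N) n (\<lambda>k. N #> s k) \<psi>"
    by (rule twin_coordinates.intro[OF involution_generated_quotient[OF \<open>N \<lhd> G\<close>]])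
      (unfold_locales, use \<psi> gen_closed coord_gen in auto)
  then show thesis using \<psi>(2) by (rule that)
qed

lemma twin_coordinates_exist:
  obtains \<phi> where "twin_coordinates (twin_group n) n (twin_gen n) \<phi>"
proof -
  have "\<exists>h\<in>hom (twin_group n) dihedral. \<forall>k\<in>{1..<n}. h (twin_gen n k) = coord_gen m k" for m
    by (rule twin_group_universal[OF group_dihedral])
      (use coord_gen_closed coord_gen_square coord_gen_commute in blast)+
  then obtain \<phi> where "\<And>m. \<phi> m \<in> hom (twin_group n) dihedral"
    "\<And>m k. k \<in> {1..<n} \<Longrightarrow> \<phi> m (twin_gen n k) = coord_gen m k" by metis
  then have "twin_coordinates (twin_group n) n (twin_gen n) \<phi>"
    by (intro twin_coordinates.intro twin_group_involutions twin_coordinates_axioms.intro)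
  then show thesis by (rule that)
qed

text \<open>An element that acts trivially in all coordinates lies in the commutator subgroup because its
  exponents vanish modulo 2, and its class in the metabelian quotient is then trivial because the
  coordinates are injective on the commutator subgroup of that quotient. The translations found in the
  quotient lift to the twin group.\<close>

lemma twin_group_coordinates:
  assumes "n \<ge> 3"
  defines "T \<equiv> twin_group n"
  obtains \<phi> where "twin_coordinates T n (twin_gen n) \<phi>"
    "\<And>x. x \<in> carrier T \<Longrightarrow>
      x \<in> second_commutator_subgroup T \<longleftrightarrow> (\<forall>m<2 * n - 5. \<phi> m x = (0, 1))"
    "\<And>w. \<exists>x\<in>carrier T. \<forall>m<2 * n - 5. \<phi> m x = (4 * w m, 1)"
proof -
  obtain \<phi> where \<phi>: "twin_coordinates T n (twin_gen n) \<phi>"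
    unfolding T_def by (rule twin_coordinates_exist)
  interpret T: twin_coordinates T n "twin_gen n" \<phi> by (rule \<phi>)
  define N where "N = derived T (derived T (carrier T))"
  have "N \<lhd> T" unfolding N_def by (rule T.second_derived_normal)
  interpret N: normal N T by fact
  obtain \<psi> where "twin_coordinates (T Mod N) n (\<lambda>k. N #>\<^bsub>T\<^esub> twin_gen n k) \<psi>"
    and \<psi>: "\<And>m x. x \<in> carrier T \<Longrightarrow> \<psi> m (N #>\<^bsub>T\<^esub> x) = \<phi> m x"
    using T.coordinates_descend unfolding N_def by metis
  then interpret Q: twin_coordinates "T Mod N" n "\<lambda>k. N #>\<^bsub>T\<^esub> twin_gen n k" \<psi> by simp
  interpret Q: metabelian_twin_coordinates "T Mod N" n "\<lambda>k. N #>\<^bsub>T\<^esub> twin_gen n k" \<psi>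
  proof
    fix i j assume ij: "i \<in> {1..<n}" "j \<in> {1..<n}" "\<bar>int i - int j\<bar> \<ge> 2"
    show "(N #>\<^bsub>T\<^esub> twin_gen n i) \<otimes>\<^bsub>T Mod N\<^esub> (N #>\<^bsub>T\<^esub> twin_gen n j) =
        (N #>\<^bsub>T\<^esub> twin_gen n j) \<otimes>\<^bsub>T Mod N\<^esub> (N #>\<^bsub>T\<^esub> twin_gen n i)"
      using T.gen_closed[OF ij(1)] T.gen_closed[OF ij(2)] twin_gens_commute[OF ij, folded T_def]
      by (simp add: N.rcos_sum)
  next
    fix X Y
    assume "X \<in> derived (T Mod N) (carrier (T Mod N))" "Y \<in> derived (T Mod N) (carrier (T Mod N))"
    then show "X \<otimes>\<^bsub>T Mod N\<^esub> Y = Y \<otimes>\<^bsub>T Mod N\<^esub> X"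
      unfolding N_def by (rule T.derived_Mod_second_derived_commute)
  qed
  have N_eq: "second_commutator_subgroup T = N"
    by (simp add: N_def second_commutator_subgroup_def commutator_subgroup_def)
  have DQ: "derived (T Mod N) (carrier (T Mod N)) = (\<lambda>x. N #>\<^bsub>T\<^esub> x) ` derived T (carrier T)"
    by (rule T.derived_Mod[OF \<open>N \<lhd> T\<close>])
  obtain ab where ab: "ab \<in> hom T (product_group {1..<n} (\<lambda>_. integer_mod_group 2))"
    "\<And>k. k \<in> {1..<n} \<Longrightarrow> ab (twin_gen n k) = (\<lambda>j\<in>{1..<n}. if j = k then 1 else 0)"
    using twin_group_to_Z2_power[of n] unfolding Z2_power_eq T_def by blast
  show thesis
  proof (rule that[OF \<phi>])
    fix x assume x: "x \<in> carrier T"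
    show "x \<in> second_commutator_subgroup T \<longleftrightarrow> (\<forall>m<2 * n - 5. \<phi> m x = (0, 1))"
    proof
      assume "x \<in> second_commutator_subgroup T"
      then show "\<forall>m<2 * n - 5. \<phi> m x = (0, 1)"
        using T.coord_second_derived unfolding N_eq N_def by blast
    next
      assume ker: "\<forall>m<2 * n - 5. \<phi> m x = (0, 1)"
      then have "x \<in> derived T (carrier T)"
        using T.coord_kernel_derived[OF assms(1) ab x] by blast
      then have "N #>\<^bsub>T\<^esub> x \<in> derived (T Mod N) (carrier (T Mod N))" unfolding DQ by blast
      then have "N #>\<^bsub>T\<^esub> x = \<one>\<^bsub>T Mod N\<^esub>"
        by (rule Q.coord_inj_on_D) (use ker \<psi>[OF x] in simp)
      then show "x \<in> second_commutator_subgroup T"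
        using T.rcos_self[OF x N.subgroup_axioms] unfolding N_eq by simp
    qed
  next
    fix w :: "nat \<Rightarrow> int"
    obtain X where X: "X \<in> derived (T Mod N) (carrier (T Mod N))"
      "\<And>m. m < 2 * n - 5 \<Longrightarrow> \<psi> m X = (4 * w m, 1)"
      using Q.coord_contains_lattice[of w] by blast
    then obtain x where x: "x \<in> derived T (carrier T)" "X = N #>\<^bsub>T\<^esub> x" unfolding DQ by blast
    have "x \<in> carrier T" using x(1) T.derived_in_carrier[OF subset_refl] by blast
    then show "\<exists>x\<in>carrier T. \<forall>m<2 * n - 5. \<phi> m x = (4 * w m, 1)"
      using X(2) \<psi> x(2) by (intro bexI[of _ x]) simp_all
  qed
qed

text \<open>The product of all coordinates is a homomorphism to the isometry group of Euclidean space whose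
  kernel is the second commutator subgroup. Its image consists of integral matrices and vectors and
  contains a full lattice of translations.\<close>

lemma twin_quotient_crystallographic:
  assumes "n \<ge> 3"
  defines "T \<equiv> twin_group n"
  shows "crystallographic_group (2 * n - 5) (T Mod second_commutator_subgroup T)"
proof -
  let ?d = "2 * n - 5" and ?E = "euclidean_isometry_group (2 * n - 5)"
  obtain \<phi> where "twin_coordinates T n (twin_gen n) \<phi>"
    and ker: "\<And>x. x \<in> carrier T \<Longrightarrow>
      x \<in> second_commutator_subgroup T \<longleftrightarrow> (\<forall>m<2 * n - 5. \<phi> m x = (0, 1))"
    and lattice: "\<And>w. \<exists>x\<in>carrier T. \<forall>m<2 * n - 5. \<phi> m x = (4 * w m, 1)"
    using twin_group_coordinates[OF assms(1)] unfolding T_def by blast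
  then interpret T: twin_coordinates T n "twin_gen n" \<phi> by simp
  define \<Phi> where "\<Phi> x = signed_translation ?d (\<lambda>m. \<phi> m x)" for x
  interpret E: group ?E by (rule group_euclidean_isometry)
  have hom: "\<Phi> \<in> hom T ?E"
  proof (rule homI)
    fix x y assume "x \<in> carrier T" "y \<in> carrier T"
    then show "\<Phi> (x \<otimes>\<^bsub>T\<^esub> y) = \<Phi> x \<otimes>\<^bsub>?E\<^esub> \<Phi> y"
      unfolding \<Phi>_def signed_translation_mult by (simp only: T.coord_mult)
  qed (unfold \<Phi>_def, intro signed_translation_closed T.coord_closed)
  interpret \<Phi>: group_hom T ?E \<Phi>
    by (rule group_hom.intro[OF T.is_group E.is_group]) (simp add: group_hom_axioms_def hom)
  let ?H = "\<Phi> ` carrier T"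
  have H: "subgroup ?H ?E" by (rule \<Phi>.subgroup_img_is_subgroup[OF T.subgroup_self])
  have one: "\<one>\<^bsub>?E\<^esub> = signed_translation ?d (\<lambda>_. (0, 1))"
    using \<Phi>.hom_one by (simp only: \<Phi>_def T.coord_one)
  have "\<Phi> x = \<one>\<^bsub>?E\<^esub> \<longleftrightarrow> (\<forall>m<2 * n - 5. \<phi> m x = (0, 1))" for x
    unfolding \<Phi>_def one signed_translation_eq_iff by (rule HOL.refl)
  moreover have "second_commutator_subgroup T \<subseteq> carrier T"
    using T.second_derived_normal normal_imp_subgroup subgroup.subset
    unfolding second_commutator_subgroup_def commutator_subgroup_def by blast
  ultimately have kernel: "kernel T ?E \<Phi> = second_commutator_subgroup T"
    using ker unfolding kernel_def by blast
  interpret \<Phi>H: group_hom T "?E\<lparr>carrier := ?H\<rparr>" \<Phi>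
    by (rule group_hom.intro[OF T.is_group E.subgroup_imp_group[OF H]])
      (use hom in \<open>auto simp: group_hom_axioms_def hom_def\<close>)
  have "kernel T (?E\<lparr>carrier := ?H\<rparr>) \<Phi> = kernel T ?E \<Phi>" by (simp add: kernel_def)
  then have iso: "T Mod second_commutator_subgroup T \<cong> ?E\<lparr>carrier := ?H\<rparr>"
    using \<Phi>H.FactGroup_iso kernel by simp
  have "discrete_subgroup ?d ?H"
    by (rule discrete_subgroup_if_signed_translations[OF H]) (auto simp: \<Phi>_def)
  moreover have "uniform_subgroup ?d ?H"
  proof (rule uniform_subgroup_if_lattice[OF H, of 4])
    fix w :: "nat \<Rightarrow> int"
    obtain x where "x \<in> carrier T" "\<forall>m<2 * n - 5. \<phi> m x = (4 * w m, 1)" using lattice by blast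
    then have "\<Phi> x = signed_translation ?d (\<lambda>m. (4 * w m, 1))" "x \<in> carrier T"
      unfolding \<Phi>_def signed_translation_eq_iff by auto
    then show "signed_translation ?d (\<lambda>m. (4 * w m, 1)) \<in> ?H" by (metis imageI)
  qed simp
  moreover have "group (T Mod second_commutator_subgroup T)"
    using normal.factorgroup_is_group[OF T.second_derived_normal]
    by (simp add: second_commutator_subgroup_def commutator_subgroup_def)
  ultimately show ?thesis using iso unfolding crystallographic_group_def by blast
qed

text \<open>The class of the first generator has order 2: it is not trivial, since this generator acts as a
  reflection in coordinate 0. Conversely, the square of an element that is torsion modulo the second
  commutator subgroup acts trivially in every coordinate.\<close>

lemma twin_quotient_torsion:
  assumes "n \<ge> 3"
  defines "T \<equiv> twin_group n"
  defines "Q \<equiv> T Mod second_commutator_subgroup T"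
  shows "\<exists>X\<in>carrier Q. X \<noteq> \<one>\<^bsub>Q\<^esub> \<and> group.ord Q X \<noteq> 0"
    and "\<And>X. X \<in> carrier Q \<Longrightarrow> X \<noteq> \<one>\<^bsub>Q\<^esub> \<Longrightarrow> group.ord Q X \<noteq> 0 \<Longrightarrow> group.ord Q X = 2"
proof -
  obtain \<phi> where "twin_coordinates T n (twin_gen n) \<phi>"
    and ker: "\<And>x. x \<in> carrier T \<Longrightarrow>
      x \<in> second_commutator_subgroup T \<longleftrightarrow> (\<forall>m<2 * n - 5. \<phi> m x = (0, 1))"
    and "\<And>w. \<exists>x\<in>carrier T. \<forall>m<2 * n - 5. \<phi> m x = (4 * w m, 1)"
    using twin_group_coordinates[OF assms(1)] unfolding T_def by blast
  then interpret T: twin_coordinates T n "twin_gen n" \<phi> by simp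
  let ?N = "second_commutator_subgroup T"
  have "?N \<lhd> T"
    using T.second_derived_normal by (simp add: second_commutator_subgroup_def commutator_subgroup_def)
  interpret N: normal ?N T by fact
  interpret Q: group Q unfolding Q_def by (rule N.factorgroup_is_group)
  have triv: "?N #>\<^bsub>T\<^esub> x = \<one>\<^bsub>Q\<^esub> \<longleftrightarrow> x \<in> ?N" if "x \<in> carrier T" for x
    using T.coset_join1[OF _ that N.subgroup_axioms] N.rcos_const[OF T.is_group] that by (auto simp: Q_def)
  have pow: "(?N #>\<^bsub>T\<^esub> x) [^]\<^bsub>Q\<^esub> (k :: nat) = ?N #>\<^bsub>T\<^esub> (x [^]\<^bsub>T\<^esub> k)" if "x \<in> carrier T" for x k
    unfolding Q_def by (rule N.FactGroup_pow[OF that])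
  show two: "group.ord Q X = 2" if X: "X \<in> carrier Q" "X \<noteq> \<one>\<^bsub>Q\<^esub>" "group.ord Q X \<noteq> 0" for X
  proof -
    obtain x where x: "x \<in> carrier T" "X = ?N #>\<^bsub>T\<^esub> x" using X(1) by (auto simp: Q_def carrier_FactGroup)
    have "x [^]\<^bsub>T\<^esub> group.ord Q X \<in> ?N"
      using Q.pow_ord_eq_1[OF X(1)] pow[OF x(1)] triv x by simp
    then have "\<forall>m<2 * n - 5. \<phi> m (x [^]\<^bsub>T\<^esub> group.ord Q X) = (0, 1)" using ker x(1) by simp
    then have "\<forall>m<2 * n - 5. \<phi> m (x \<otimes>\<^bsub>T\<^esub> x) = (0, 1)"
      using T.coord_square_if_torsion[OF x(1)] X(3) by blast
    then have "x \<otimes>\<^bsub>T\<^esub> x \<in> ?N" using ker x(1) by simp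
    then have "X [^]\<^bsub>Q\<^esub> (2 :: nat) = \<one>\<^bsub>Q\<^esub>"
      using pow[OF x(1), of 2] triv x by (simp add: numeral_2_eq_2)
    then have "group.ord Q X dvd 2" using Q.pow_eq_id[OF X(1)] by blast
    moreover have "group.ord Q X \<noteq> 1" using Q.ord_eq_1[OF X(1)] X(2) by blast
    ultimately show ?thesis using X(3) by (metis prime_nat_iff two_is_prime_nat)
  qed
  have k: "1 \<in> {1..<n}" using assms(1) by simp
  let ?s = "twin_gen n 1"
  have "\<phi> 0 ?s = (0, - 1)" using T.coord_gen[OF k, of 0] by (simp add: coord_gen_def)
  then have "?s \<notin> ?N" using ker[OF T.gen_closed[OF k]] assms(1) by force
  then have ne: "?N #>\<^bsub>T\<^esub> ?s \<noteq> \<one>\<^bsub>Q\<^esub>" using triv[OF T.gen_closed[OF k]] by simp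
  have c: "?N #>\<^bsub>T\<^esub> ?s \<in> carrier Q" using T.gen_closed[OF k] by (auto simp: Q_def carrier_FactGroup)
  have "(?N #>\<^bsub>T\<^esub> ?s) [^]\<^bsub>Q\<^esub> (2 :: nat) = \<one>\<^bsub>Q\<^esub>"
    using pow[OF T.gen_closed[OF k], of 2] triv[of "\<one>\<^bsub>T\<^esub>"] T.gen_square[OF k] T.gen_closed[OF k]
    by (simp add: numeral_2_eq_2)
  then have "group.ord Q (?N #>\<^bsub>T\<^esub> ?s) \<noteq> 0" using Q.pow_eq_id[OF c, of 2] by (metis dvd_0_left_iff zero_neq_numeral)
  then show "\<exists>X\<in>carrier Q. X \<noteq> \<one>\<^bsub>Q\<^esub> \<and> group.ord Q X \<noteq> 0" using ne c by blast
qed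

lemma (in group) Mod_short_exact:
  assumes "N \<lhd> G" "K \<lhd> G" "N \<subseteq> K" and "group Z" and p: "p \<in> epi (G Mod N) Z"
    and ker: "\<And>x. x \<in> carrier G \<Longrightarrow> p (N #> x) = \<one>\<^bsub>Z\<^esub> \<longleftrightarrow> x \<in> K"
  shows "short_exact (G\<lparr>carrier := K\<rparr> Mod N) (G Mod N) Z (\<lambda>x. x) p"
proof -
  have K: "subgroup K G" by (rule normal_imp_subgroup[OF assms(2)])
  have NK: "N \<lhd> G\<lparr>carrier := K\<rparr>"
    by (rule normal_restrict_supergroup[OF K assms(1,3)])
  have carr: "carrier (G\<lparr>carrier := K\<rparr> Mod N) = (\<lambda>x. N #> x) ` K"
    by (auto simp: carrier_FactGroup r_coset_def)
  have KG: "K \<subseteq> carrier G" by (rule subgroup.subset[OF K])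
  have hom: "(\<lambda>x. x) \<in> mon (G\<lparr>carrier := K\<rparr> Mod N) (G Mod N)"
    unfolding mon_def hom_def carr using KG by (auto simp: carrier_FactGroup set_mult_def)
  have "(\<lambda>x. x) ` carrier (G\<lparr>carrier := K\<rparr> Mod N) = kernel (G Mod N) Z p"
    unfolding carr kernel_def using KG ker by (auto simp: carrier_FactGroup)
  then show ?thesis
    unfolding short_exact_def
    using hom p \<open>group Z\<close> normal.factorgroup_is_group[OF NK] normal.factorgroup_is_group[OF assms(1)]
    by blast
qed

theorem theorem4p9:
  fixes n :: nat
  assumes "n \<ge> 3"
  defines "T \<equiv> twin_group n"
  defines "T' \<equiv> commutator_subgroup T"
  defines "T'' \<equiv> second_commutator_subgroup T"
  shows
    "(\<exists>ab p.
        ab \<in> epi T (Z2_power (n - 1)) \<and>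
        (\<forall>k\<in>{1..<n}. ab (twin_gen n k) = (\<lambda>j\<in>{1..n - 1}. if j = k then 1 else 0)) \<and>
        kernel T (Z2_power (n - 1)) ab = T' \<and>
        (\<forall>x\<in>carrier T. p (T'' #>\<^bsub>T\<^esub> x) = ab x) \<and>
        short_exact (T\<lparr>carrier := T'\<rparr> Mod T'') (T Mod T'') (Z2_power (n - 1)) (\<lambda>x. x) p)
     \<and> crystallographic_group (2 * n - 5) (T Mod T'')
     \<and> \<not> bieberbach_group (T Mod T'')
     \<and> (\<forall>x\<in>carrier (T Mod T''). x \<noteq> \<one>\<^bsub>T Mod T''\<^esub> \<and> group.ord (T Mod T'') x \<noteq> 0
           \<longrightarrow> group.ord (T Mod T'') x = 2)"
proof (intro conjI)
  let ?Z = "Z2_power (n - 1)"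
  interpret T: involution_generated_group T "{1..<n}" "twin_gen n"
    unfolding T_def by (rule twin_group_involutions)
  have Z: "group ?Z" unfolding Z2_power_eq by simp
  have T': "T' = derived T (carrier T)" by (simp add: T'_def commutator_subgroup_def)
  have T'': "T'' = derived T T'" by (simp add: T''_def T'_def second_commutator_subgroup_def)
  have normal: "T' \<lhd> T" "T'' \<lhd> T" unfolding T'' T'
    by (rule T.derived_self_is_normal, rule T.second_derived_normal)
  have sub: "T'' \<subseteq> T'"
    unfolding T'' by (rule T.derived_incl[OF subset_refl normal_imp_subgroup[OF normal(1)]])
  obtain ab where ab: "ab \<in> hom T ?Z"
    and gens: "\<And>k. k \<in> {1..<n} \<Longrightarrow> ab (twin_gen n k) = (\<lambda>j\<in>{1..<n}. if j = k then 1 else 0)"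
    using twin_group_to_Z2_power[of n] unfolding T_def by blast
  have epi: "ab \<in> epi T ?Z"
    using T.Z2_product_epi[OF _ ab[unfolded Z2_power_eq] gens] unfolding Z2_power_eq by simp
  have ker: "kernel T ?Z ab = T'"
    using T.kernel_Z2_product[OF _ ab[unfolded Z2_power_eq] gens] unfolding Z2_power_eq T' by simp
  interpret ab: group_hom T ?Z ab
    by (rule group_hom.intro[OF T.is_group Z group_hom_axioms.intro[OF ab]])
  have "ab x = ab y" if xy: "x \<in> carrier T" "y \<in> carrier T" "T'' #>\<^bsub>T\<^esub> x = T'' #>\<^bsub>T\<^esub> y" for x y
  proof -
    have "x \<in> T'' #>\<^bsub>T\<^esub> y"
      using T.rcos_self[OF xy(1) normal_imp_subgroup[OF normal(2)]] xy(3) by simp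
    then obtain z where z: "z \<in> T''" "x = z \<otimes>\<^bsub>T\<^esub> y" by (auto simp: r_coset_def)
    then have "z \<in> carrier T" "ab z = \<one>\<^bsub>?Z\<^esub>" using sub ker unfolding kernel_def by blast+
    then show ?thesis using z(2) xy(2) ab.hom_mult ab.hom_closed ab.H.l_one by metis
  qed
  then obtain p where p: "p \<in> hom (T Mod T'') ?Z"
    and p_eq: "\<And>x. x \<in> carrier T \<Longrightarrow> p (T'' #>\<^bsub>T\<^esub> x) = ab x"
    using FactGroup_universal[OF ab normal(2)] by blast
  have "p ` carrier (T Mod T'') = ab ` carrier T"
    unfolding carrier_FactGroup image_image using p_eq by (rule image_cong[OF HOL.refl])
  then have p_epi: "p \<in> epi (T Mod T'') ?Z" using p epi unfolding epi_def by simp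
  have "short_exact (T\<lparr>carrier := T'\<rparr> Mod T'') (T Mod T'') ?Z (\<lambda>x. x) p"
    by (rule T.Mod_short_exact[OF normal(2,1) sub Z p_epi])
      (use p_eq ker in \<open>auto simp: kernel_def\<close>)
  moreover have "{1..n - 1} = {1..<n}" by auto
  ultimately show "\<exists>ab p. ab \<in> epi T ?Z \<and>
      (\<forall>k\<in>{1..<n}. ab (twin_gen n k) = (\<lambda>j\<in>{1..n - 1}. if j = k then 1 else 0)) \<and>
      kernel T ?Z ab = T' \<and> (\<forall>x\<in>carrier T. p (T'' #>\<^bsub>T\<^esub> x) = ab x) \<and>
      short_exact (T\<lparr>carrier := T'\<rparr> Mod T'') (T Mod T'') ?Z (\<lambda>x. x) p"
    using epi gens ker p_eq by (intro exI[of _ ab] exI[of _ p]) simp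
  show "crystallographic_group (2 * n - 5) (T Mod T'')"
    unfolding T''_def T_def by (rule twin_quotient_crystallographic[OF assms(1)])
  have "\<exists>x\<in>carrier (T Mod T''). x \<noteq> \<one>\<^bsub>T Mod T''\<^esub> \<and> group.ord (T Mod T'') x \<noteq> 0"
    unfolding T''_def T_def by (rule twin_quotient_torsion(1)[OF assms(1)])
  then obtain x where "x \<in> carrier (T Mod T'')" "x \<noteq> \<one>\<^bsub>T Mod T''\<^esub>" "group.ord (T Mod T'') x \<noteq> 0"
    by (elim bexE conjE)
  then show "\<not> bieberbach_group (T Mod T'')"
    unfolding bieberbach_group_def torsion_free_group_def by (intro notI) (elim conjE, drule (1) bspec, simp only: simp_thms)
  show "\<forall>x\<in>carrier (T Mod T''). x \<noteq> \<one>\<^bsub>T Mod T''\<^esub> \<and> group.ord (T Mod T'') x \<noteq> 0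
      \<longrightarrow> group.ord (T Mod T'') x = 2"
  proof (intro ballI impI)
    fix x assume "x \<in> carrier (T Mod T'')"
      and "x \<noteq> \<one>\<^bsub>T Mod T''\<^esub> \<and> group.ord (T Mod T'') x \<noteq> 0"
    then show "group.ord (T Mod T'') x = 2"
      unfolding T''_def T_def by (elim conjE) (rule twin_quotient_torsion(2)[OF assms(1)])
  qed
qed

end
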